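(* Let $\Omega$ be a bounded hyperconvex domain in $\mathbb C^n$ and let $w\in\Omega$. Then $$\lim_{t\to-\infty}e^{-2nt}\,\lambda(\{z\in\Omega: G_{\Omega,w}(z)<t\})=\lambda(I^A_\Omega(w)),$$ where $G_{\Omega,w}$ is the pluricomplex Green function of $\Omega$ with pole at $w$ and $I^A_\Omega(w)$ is the Azukawa indicatrix of $\Omega$ at $w$.
   Context: $\lambda$ is Lebesgue measure on $\mathbb C^n\cong\mathbb R^{2n}$ and $|\cdot|$ is the Euclidean norm. A bounded domain is hyperconvex if it admits a negative continuous plurisubharmonic exhaustion function, i.e. a continuous plurisubharmonic $\rho:\Omega\to(-\infty,0)$ with $\{\rho<c\}$ relatively compact in $\Omega$ for every $c<0$. The pluricomplex Green function with pole at $w$ is $$G_{\Omega,w}=\sup\{u\in PSH^-(\Omega): u\le \log|\cdot-w|+C\text{ near }w\text{ for some constant }C\},$$ where $PSH^-(\Omega)$ is the set of negative plurisubharmonic functions on $\Omega$. The Azukawa indicatrix is $$I^A_\Omega(w)=\Big\{X\in\mathbb C^n:\ \limsup_{\zeta\to0}\big(G_{\Omega,w}(w+\zeta X)-\log|\zeta|\big)<0\Big\},$$ with $\zeta\in\mathbb C\setminus\{0\}$. *)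

theory Defs
  imports "HOL-Analysis.Analysis"
begin

text \<open>
  Functions with values in the interval from \<open>-\<infinity>\<close> (included) to \<open>\<infinity>\<close> (excluded) are represented as
  total functions into \<^typ>\<open>ereal\<close>; every notion below only uses their values on the given set.
\<close>

definition usc_on :: "'a::topological_space set \<Rightarrow> ('a \<Rightarrow> ereal) \<Rightarrow> bool" where
  "usc_on U u \<longleftrightarrow> (\<forall>c. openin (top_of_set U) {z \<in> U. u z < c})"

text \<open>
  The circle mean is the extended-real Lebesgue integral, positive part minus negative part.
  For an upper semicontinuous function \<open>v < \<infinity>\<close> the positive part has a finite integral, so
  the undefined expression \<open>\<infinity> - \<infinity>\<close> does not occur.
\<close>

definition circle_mean :: "(complex \<Rightarrow> ereal) \<Rightarrow> complex \<Rightarrow> real \<Rightarrow> ereal" where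
  "circle_mean v a r = ereal (1 / (2 * pi)) *
     (enn2ereal (\<integral>\<^sup>+ t\<in>{0..2*pi}. e2ennreal (v (a + of_real r * cis t)) \<partial>lborel)
    - enn2ereal (\<integral>\<^sup>+ t\<in>{0..2*pi}. e2ennreal (- v (a + of_real r * cis t)) \<partial>lborel))"

text \<open>The constant \<open>-\<infinity>\<close> counts as subharmonic and as plurisubharmonic.\<close>

definition subharmonic_on :: "complex set \<Rightarrow> (complex \<Rightarrow> ereal) \<Rightarrow> bool" where
  "subharmonic_on U v \<longleftrightarrow> usc_on U v \<and> (\<forall>\<zeta>\<in>U. v \<zeta> < \<infinity>) \<and>
     (\<forall>a r. 0 < r \<and> cball a r \<subseteq> U \<longrightarrow> v a \<le> circle_mean v a r)"

definition psh_on :: "(complex ^ 'n) set \<Rightarrow> (complex ^ 'n \<Rightarrow> ereal) \<Rightarrow> bool" where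
  "psh_on \<Omega> u \<longleftrightarrow> usc_on \<Omega> u \<and> (\<forall>z\<in>\<Omega>. u z < \<infinity>) \<and>
     (\<forall>a X. subharmonic_on {\<zeta>. a + \<zeta> *s X \<in> \<Omega>} (\<lambda>\<zeta>. u (a + \<zeta> *s X)))"

definition bounded_hyperconvex_domain :: "(complex ^ 'n) set \<Rightarrow> bool" where
  "bounded_hyperconvex_domain \<Omega> \<longleftrightarrow>
     open \<Omega> \<and> connected \<Omega> \<and> \<Omega> \<noteq> {} \<and> bounded \<Omega> \<and>
     (\<exists>\<rho> :: complex ^ 'n \<Rightarrow> real.
        continuous_on \<Omega> \<rho> \<and> psh_on \<Omega> (\<lambda>z. ereal (\<rho> z)) \<and> (\<forall>z\<in>\<Omega>. \<rho> z < 0) \<and>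
        (\<forall>c<0. compact (closure {z \<in> \<Omega>. \<rho> z < c}) \<and> closure {z \<in> \<Omega>. \<rho> z < c} \<subseteq> \<Omega>))"

text \<open>Logarithm with \<open>log 0 = -\<infinity>\<close>, whereas \<open>ln 0 = 0\<close> holds for the real \<^const>\<open>ln\<close>.\<close>

definition elog :: "real \<Rightarrow> ereal" where
  "elog x = (if x = 0 then -\<infinity> else ereal (ln x))"

definition green_family :: "(complex ^ 'n) set \<Rightarrow> complex ^ 'n \<Rightarrow> (complex ^ 'n \<Rightarrow> ereal) set" where
  "green_family \<Omega> w = {u. psh_on \<Omega> u \<and> (\<forall>z\<in>\<Omega>. u z < 0) \<and>
     (\<exists>C::real. \<forall>\<^sub>F z in nhds w. u z \<le> elog (norm (z - w)) + ereal C)}"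

definition green :: "(complex ^ 'n) set \<Rightarrow> complex ^ 'n \<Rightarrow> complex ^ 'n \<Rightarrow> ereal" where
  "green \<Omega> w z = (SUP u\<in>green_family \<Omega> w. u z)"

text \<open>For open \<open>\<Omega>\<close> containing \<open>w\<close>, the point \<open>w + \<zeta> *s X\<close> lies in \<open>\<Omega>\<close> for all small \<open>\<zeta>\<close>.\<close>

definition azukawa_indicatrix :: "(complex ^ 'n) set \<Rightarrow> complex ^ 'n \<Rightarrow> (complex ^ 'n) set" where
  "azukawa_indicatrix \<Omega> w =
     {X. Limsup (at 0) (\<lambda>\<zeta>::complex. green \<Omega> w (w + \<zeta> *s X) - elog (norm \<zeta>)) < 0}"

end

theory Submission
  imports Defs "HOL-Complex_Analysis.Complex_Analysis"
begin

text \<open>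
  Put \<open>g\<^sub>t(X) = G(w + e\<^sup>t X) - t\<close> and \<open>A(X) = limsup (G(w + \<zeta>X) - log |\<zeta>|)\<close>. After rescaling, the claim is
  \<open>\<lambda>{g\<^sub>t < 0} \<rightarrow> \<lambda>{A < 0}\<close>. Rotation invariance of \<open>\<lambda>\<close> and Tonelli's theorem turn \<open>\<lambda>{g\<^sub>t < 0}\<close> into
  the integral over \<open>X\<close> of the proportion of angles \<open>\<theta>\<close> with \<open>g\<^sub>t(e\<^sup>i\<^sup>\<theta> X) < 0\<close>, to which dominated
  convergence applies. This proportion is eventually 1 if \<open>A(X) < 0\<close>. If \<open>A(X) > 0\<close>, it tends
  to 0: the function \<open>v(\<zeta>) = G(w + \<zeta>X) - log |\<zeta>|\<close> is subharmonic across the puncture with value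
  \<open>A(X)\<close> at 0 and has upper limit \<open>A(X)\<close> there, so the submean inequality prevents it from being
  negative on a large part of a small circle. By homogeneity of \<open>A\<close>, the set \<open>{A = 0}\<close> is null.
  The submean inequality at the puncture comes from comparing \<open>v\<close> with real parts of polynomials,
  which approximate continuous functions on the circle.
\<close>


section \<open>Upper semicontinuous functions and circle means\<close>

text \<open>An upper limit at the puncture does not by itself exclude very low values along a sparse
  set of \<open>\<zeta>\<close>, so it gives no pointwise convergence of \<open>g_t(X)\<close>. What
  the submean inequality controls is the total angle occupied by such values on a small circle; this
  is why rotations enter before the limit is taken.

  Circle means are differences of two extended-valued integrals and are awkward to add or to pass to
  limits in. Submean inequalities are therefore proved by testing against continuous real functions
  strictly above the given function on the circle. Strictness and upper semicontinuity make such a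
  comparison stable under small moves of the circle, so that compactness (the tube lemma) can
  replace limit theorems.

  Neither \<open>A\<close> nor the extension of \<open>v\<close> across the puncture is constructed.
  Bounds on \<open>A(X)\<close> are expressed by constants \<open>c\<close> with
  \<open>G(w + \<zeta>X) \<le> log |\<zeta>| + c\<close> on some small disc, and the value at the
  puncture by the infimum of these constants.\<close>

lemma usc_attains_max:
  assumes "compact K" "K \<noteq> {}" "usc_on K u"
  obtains x where "x \<in> K" "\<And>y. y \<in> K \<Longrightarrow> u y \<le> u x"
proof -
  have "\<exists>x\<in>K. \<forall>y\<in>K. u y \<le> u x"
  proof (rule ccontr)
    assume *: "\<not> ?thesis"
    let ?C = "(\<lambda>x. {z \<in> K. u z < u x}) ` K"
    have "\<forall>T\<in>?C. openin (top_of_set K) T"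
      using assms(3) by (auto simp: usc_on_def)
    moreover have "K \<subseteq> \<Union>?C"
      using * by (auto simp: not_le)
    ultimately obtain D where D: "D \<subseteq> ?C" "finite D" "K \<subseteq> \<Union>D"
      using assms(1) unfolding compact_eq_openin_cover by meson
    then obtain F where F: "F \<subseteq> K" "finite F" "D = (\<lambda>x. {z \<in> K. u z < u x}) ` F"
      by (meson finite_subset_image)
    have "F \<noteq> {}" using D F assms(2) by auto
    then have "Max (u ` F) \<in> u ` F" using F(2) by (intro Max_in) auto
    then obtain m where m: "m \<in> F" "u m = Max (u ` F)" by auto
    then have "u x \<le> u m" if "x \<in> F" for x using F(2) that by simp
    moreover obtain x where "x \<in> F" "u m < u x" using D(3) F(1,3) m(1) by blast
    ultimately show False by (simp add: leD)
  qed
  then show ?thesis using that by blast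
qed

lemma usc_on_compose:
  assumes "usc_on U u" "continuous_on V f" "f ` V \<subseteq> U"
  shows "usc_on V (\<lambda>x. u (f x))"
  unfolding usc_on_def
proof
  fix c
  have "openin (top_of_set V) (V \<inter> f -` {z \<in> U. u z < c})"
    using assms by (intro continuous_openin_preimage[where T=U]) (auto simp: usc_on_def)
  also have "V \<inter> f -` {z \<in> U. u z < c} = {z \<in> V. u (f z) < c}"
    using assms(3) by auto
  finally show "openin (top_of_set V) {z \<in> V. u (f z) < c}" .
qed

lemma usc_on_subset: "usc_on U u \<Longrightarrow> V \<subseteq> U \<Longrightarrow> usc_on V u"
  using usc_on_compose[of U u V "\<lambda>x. x"] by auto

lemma usc_on_continuous: "continuous_on U u \<Longrightarrow> usc_on U u"
  using continuous_openin_preimage_gen[of U u "{..<c}" for c]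
  by (auto simp: usc_on_def vimage_def Int_def)

lemma usc_on_add_continuous:
  fixes b :: "'a::topological_space \<Rightarrow> real"
  assumes "usc_on U u" "continuous_on U b"
  shows "usc_on U (\<lambda>x. u x + ereal (b x))"
  unfolding usc_on_def
proof
  fix c
  \<comment> \<open>A real \<open>q\<close> strictly between \<open>u z\<close> and
    \<open>c - b z\<close> separates the two summands, which also covers the value
    \<open>-\<infinity>\<close> of \<open>u\<close>.\<close>
  have eq: "{z \<in> U. u z + ereal (b z) < c} =
     (\<Union>q::real. {z \<in> U. u z < ereal q} \<inter> {z \<in> U. ereal (q + b z) < c})" (is "?L = ?R")
  proof
    show "?L \<subseteq> ?R"
    proof
      fix z assume z: "z \<in> ?L"
      then have "u z < c - ereal (b z)"
        by (cases c; cases "u z") auto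
      then obtain q where "u z < ereal q" "ereal q < c - ereal (b z)"
        using ereal_dense2 by blast
      then show "z \<in> ?R" using z by (cases c) auto
    qed
    show "?R \<subseteq> ?L"
    proof
      fix z assume "z \<in> ?R"
      then obtain q where q: "z \<in> U" "u z < ereal q" "ereal (q + b z) < c" by auto
      have "u z + ereal (b z) \<le> ereal (q + b z)"
        using q(2) by (cases "u z") auto
      then show "z \<in> ?L" using q by auto
    qed
  qed
  have "openin (top_of_set U) {z \<in> U. ereal (q + b z) < c}" for q
  proof -
    have "continuous_on U (\<lambda>z. ereal (q + b z))"
      using assms(2) by (intro continuous_intros)
    from usc_on_continuous[OF this] show ?thesis by (simp add: usc_on_def)
  qed
  then show "openin (top_of_set U) {z \<in> U. u z + ereal (b z) < c}"
    unfolding eq using assms(1) by (intro openin_Union openin_Int ballI) (auto simp: usc_on_def)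
qed

lemma usc_on_open_iff:
  "open U \<Longrightarrow> usc_on U u \<longleftrightarrow> (\<forall>c. open {z \<in> U. u z < c})"
  by (auto simp: usc_on_def openin_open_eq)

section \<open>Circle means and their comparison with continuous functions\<close>

text \<open>Cauchy's formula at the centre: in the parametrized integral the kernel
  \<open>1 / (z - a)\<close> cancels against the derivative of the circle up to the factor
  \<open>\<i>\<close>.\<close>

lemma holomorphic_has_integral_circle:
  assumes "continuous_on (cball a r) f" "f holomorphic_on ball a r" "0 < r"
  shows "((\<lambda>t. f (a + of_real r * cis t)) has_integral of_real (2*pi) * f a) {0..2*pi}"
proof -
  have "((\<lambda>u. f u/(u-a)) has_contour_integral (2 * of_real pi * \<i> * f a)) (circlepath a r)"
    using Cauchy_integral_circlepath[OF assms(1,2), of a] assms(3) by simp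
  then have "((\<lambda>u. f u/(u-a)) has_contour_integral (2 * of_real pi * \<i> * f a)) (part_circlepath a r 0 (2*pi))"
    by (simp add: circlepath_def)
  then have "((\<lambda>t. f (a + of_real r * cis t) / (a + of_real r * cis t - a) * of_real r * \<i> * cis t)
      has_integral (2 * of_real pi * \<i> * f a)) {0..2*pi}"
    by (subst (asm) has_contour_integral_part_circlepath_iff) (auto simp: mult_ac)
  then have "((\<lambda>t. f (a + of_real r * cis t) * \<i>) has_integral (2 * of_real pi * \<i> * f a)) {0..2*pi}"
    by (rule has_integral_eq[rotated]) (use assms(3) in \<open>auto simp: field_simps\<close>)
  from has_integral_mult_right[OF this, of "-\<i>"] show ?thesis
    by (simp add: algebra_simps)
qed

lemma Re_holomorphic_has_integral_circle:
  assumes "continuous_on (cball a r) f" "f holomorphic_on ball a r" "0 < r"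
  shows "((\<lambda>t. Re (f (a + of_real r * cis t))) has_integral 2*pi * Re (f a)) {0..2*pi}"
  using has_integral_linear[OF holomorphic_has_integral_circle[OF assms] bounded_linear_Re]
  by (simp add: o_def)

text \<open>The bridge between gauge integrals, in which mean values of holomorphic functions are
  stated, and the two nonnegative integrals that make up \<open>circle_mean\<close>.\<close>

lemma has_integral_imp_nn_integral_diff:
  fixes g :: "real \<Rightarrow> real"
  assumes "continuous_on {a..b} g" "(g has_integral m) {a..b}"
  shows "(\<integral>\<^sup>+t\<in>{a..b}. ennreal (g t) \<partial>lborel) < \<infinity>"
    and "(\<integral>\<^sup>+t\<in>{a..b}. ennreal (- g t) \<partial>lborel) < \<infinity>"
    and "enn2real (\<integral>\<^sup>+t\<in>{a..b}. ennreal (g t) \<partial>lborel) - enn2real (\<integral>\<^sup>+t\<in>{a..b}. ennreal (- g t) \<partial>lborel) = m"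
proof -
  have int: "integrable lborel (\<lambda>t. indicator {a..b} t *\<^sub>R g t)"
    using borel_integrable_compact[OF _ assms(1)] by simp
  have eq: "(\<lambda>t. ennreal (indicator {a..b} t *\<^sub>R g t)) = (\<lambda>t. ennreal (g t) * indicator {a..b} t)"
    "(\<lambda>t. ennreal (- (indicator {a..b} t *\<^sub>R g t))) = (\<lambda>t. ennreal (- g t) * indicator {a..b} t)"
    by (auto simp: indicator_def)
  from int show "(\<integral>\<^sup>+t\<in>{a..b}. ennreal (g t) \<partial>lborel) < \<infinity>"
    "(\<integral>\<^sup>+t\<in>{a..b}. ennreal (- g t) \<partial>lborel) < \<infinity>"
    unfolding real_integrable_def eq by (auto simp: top.not_eq_extremum)
  have "integral\<^sup>L lborel (\<lambda>t. indicator {a..b} t *\<^sub>R g t) = m"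
    using set_borel_integral_eq_integral(2)[of "{a..b}" g] int assms(2)
    by (simp add: set_integrable_def set_lebesgue_integral_def integral_unique)
  with real_lebesgue_integral_def[OF int]
  show "enn2real (\<integral>\<^sup>+t\<in>{a..b}. ennreal (g t) \<partial>lborel) - enn2real (\<integral>\<^sup>+t\<in>{a..b}. ennreal (- g t) \<partial>lborel) = m"
    unfolding eq by simp
qed

text \<open>Nonnegative integrals are monotone for arbitrary integrands, so domination by
  \<open>g\<close> at each point of the circle suffices. Finiteness of both integrals of
  \<open>g\<close> makes the final difference an ordinary real number.\<close>

lemma circle_mean_le:
  assumes "continuous_on {0..2*pi} g" "(g has_integral 2*pi*m) {0..2*pi}"
    and le: "\<And>t. t \<in> {0..2*pi} \<Longrightarrow> v (a + of_real r * cis t) \<le> ereal (g t)"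
  shows "circle_mean v a r \<le> ereal m"
proof -
  let ?I = "{0..2*pi}"
  let ?gp = "\<integral>\<^sup>+t\<in>?I. ennreal (g t) \<partial>lborel" and ?gm = "\<integral>\<^sup>+t\<in>?I. ennreal (- g t) \<partial>lborel"
  let ?p = "\<integral>\<^sup>+ t\<in>?I. e2ennreal (v (a + of_real r * cis t)) \<partial>lborel"
  let ?m = "\<integral>\<^sup>+ t\<in>?I. e2ennreal (- v (a + of_real r * cis t)) \<partial>lborel"
  note g = has_integral_imp_nn_integral_diff[OF assms(1,2)]
  have "?p \<le> ?gp"
  proof (intro nn_integral_mono)
    fix t
    have "e2ennreal (v (a + of_real r * cis t)) \<le> ennreal (g t)" if "t \<in> ?I"
      using le[OF that] by (metis e2ennreal_ereal e2ennreal_mono)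
    then show "e2ennreal (v (a + of_real r * cis t)) * indicator ?I t \<le> ennreal (g t) * indicator ?I t"
      by (auto split: split_indicator)
  qed
  moreover have "?gm \<le> ?m"
  proof (intro nn_integral_mono)
    fix t
    have "ennreal (- g t) \<le> e2ennreal (- v (a + of_real r * cis t))" if "t \<in> ?I"
      using le[OF that] by (metis e2ennreal_ereal e2ennreal_mono ereal_minus_le_minus uminus_ereal.simps(1))
    then show "ennreal (- g t) * indicator ?I t \<le> e2ennreal (- v (a + of_real r * cis t)) * indicator ?I t"
      by (auto split: split_indicator)
  qed
  ultimately have "enn2ereal ?p - enn2ereal ?m \<le> enn2ereal ?gp - enn2ereal ?gm"
    by (intro ereal_minus_mono) (auto simp: less_eq_ennreal.rep_eq)
  also have "\<dots> = ereal (2*pi*m)"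
  proof -
    have "enn2ereal ?gp = ereal (enn2real ?gp)" "enn2ereal ?gm = ereal (enn2real ?gm)"
      using g(1,2) by (metis enn2ereal_ennreal enn2real_nonneg ennreal_enn2real infinity_ennreal_def)+
    then show ?thesis using g(3) by simp
  qed
  finally have "ereal (1/(2*pi)) * (enn2ereal ?p - enn2ereal ?m) \<le> ereal (1/(2*pi)) * ereal (2*pi*m)"
    by (intro ereal_mult_left_mono) auto
  then show ?thesis unfolding circle_mean_def by simp
qed

text \<open>The majorants are the Lipschitz regularizations of the truncations of \<^term>\<open>V\<close>.\<close>

lemma usc_continuous_majorants:
  fixes V :: "'a::metric_space \<Rightarrow> ereal"
  assumes K: "compact K" "K \<noteq> {}" and usc: "usc_on K V" and fin: "\<And>s. s \<in> K \<Longrightarrow> V s < \<infinity>"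
  obtains g :: "nat \<Rightarrow> 'a \<Rightarrow> real" and M :: real
  where "\<And>k. continuous_on UNIV (g k)" "\<And>k t. t \<in> K \<Longrightarrow> V t < ereal (g k t)"
    "\<And>t q. t \<in> K \<Longrightarrow> V t < ereal q \<Longrightarrow> eventually (\<lambda>k. g k t < q) sequentially"
    "\<And>k t. g k t \<le> M" "0 \<le> M" 
proof -
  obtain x0 where x0: "x0 \<in> K" "\<And>y. y \<in> K \<Longrightarrow> V y \<le> V x0"
    using usc_attains_max[OF K usc] by metis
  obtain M0 where M0: "M0 \<ge> 0" "V x0 \<le> ereal M0"
  proof (cases "V x0")
    case (real r) then show ?thesis using that[of "max r 0"] by simp
  qed (use fin x0 that[of 0] in auto)
  have VM: "V s \<le> ereal M0" if "s \<in> K" for s using x0(2)[OF that] M0 by auto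
  define vk where "vk k s = real_of_ereal (max (V s) (- ereal (real k)))" for k s
  have vk: "ereal (vk k s) = max (V s) (- ereal (real k))" if "s \<in> K" for k s
    unfolding vk_def using fin[OF that] by (cases "V s") (auto simp: max_def)
  have vkM: "vk k s \<le> M0" if "s \<in> K" for k s
  proof -
    have "max (V s) (- ereal (real k)) \<le> ereal M0"
      using VM[OF that] M0(1) by simp
    then show ?thesis using vk[OF that, of k] by (metis ereal_less_eq(3))
  qed
  define h where "h k t = (SUP s\<in>K. vk k s - real k * dist t s)" for k t
  \<comment> \<open>On \<open>K\<close> the envelope \<open>h k\<close> satisfies only the weak
    inequality \<open>V \<le> h k\<close>; the added term makes it strict and tends to 0.\<close>
  define g where "g k t = h k t + 1 / real (Suc k)" for k t
  have bdd: "bdd_above ((\<lambda>s. vk k s - real k * dist t s) ` K)" for k t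
    by (rule bdd_aboveI2[of _ _ M0]) (smt (verit) mult_nonneg_nonneg of_nat_0_le_iff vkM zero_le_dist)
  have lower: "vk k t \<le> h k t" if "t \<in> K" for k t
    unfolding h_def by (rule cSUP_upper2[OF bdd that]) simp
  have hM: "h k t \<le> M0" for k t
    unfolding h_def
    by (rule cSUP_least[OF K(2)]) (smt (verit) mult_nonneg_nonneg of_nat_0_le_iff vkM zero_le_dist)
  have lip: "h k t \<le> h k t' + real k * dist t t'" for k t t'
    unfolding h_def
  proof (rule cSUP_least[OF K(2)])
    fix s assume s: "s \<in> K"
    have "dist t' s \<le> dist t t' + dist t s" by (metis dist_commute dist_triangle)
    then have "real k * dist t' s \<le> real k * dist t t' + real k * dist t s"
      by (metis mult_left_mono of_nat_0_le_iff ring_class.ring_distribs(1))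
    then have "vk k s - real k * dist t s \<le> vk k s - real k * dist t' s + real k * dist t t'" by simp
    also have "vk k s - real k * dist t' s \<le> (SUP s\<in>K. vk k s - real k * dist t' s)"
      by (rule cSUP_upper[OF s bdd])
    finally show "vk k s - real k * dist t s \<le> (SUP s\<in>K. vk k s - real k * dist t' s) + real k * dist t t'"
      by simp
  qed
  show ?thesis
  proof (rule that[of g "M0 + 1"])
    fix k
    have "(real k)-lipschitz_on UNIV (h k)"
      using lip by (intro lipschitz_onI) (auto simp: dist_real_def abs_le_iff algebra_simps, metis dist_commute)
    then show "continuous_on UNIV (g k)"
      unfolding g_def by (intro continuous_intros lipschitz_on_continuous_on)
  next
    fix k t assume t: "t \<in> K"
    have "V t \<le> ereal (vk k t)" using vk[OF t] by simp
    also have "\<dots> < ereal (g k t)" using lower[OF t, of k] by (simp add: g_def add_pos_nonneg less_add_same_cancel1 le_less_trans)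
    finally show "V t < ereal (g k t)" .
  next
    fix t q assume t: "t \<in> K" and "V t < ereal q"
    then obtain p where p: "V t < ereal p" "p < q" using ereal_dense2 less_ereal.simps(1) by blast
    have "openin (top_of_set K) {z \<in> K. V z < ereal p}" using usc by (simp add: usc_on_def)
    then obtain d where d: "d > 0" "\<And>s. s \<in> K \<Longrightarrow> dist s t < d \<Longrightarrow> V s < ereal p"
      using t p(1) unfolding openin_euclidean_subtopology_iff by blast
    have e0: "eventually (\<lambda>k. real k \<ge> - p) sequentially"
      using filterlim_real_sequentially unfolding filterlim_at_top by blast
    have e1: "eventually (\<lambda>k. real k \<ge> (M0 - p) / d) sequentially"
      using filterlim_real_sequentially unfolding filterlim_at_top by blast
    have e2: "eventually (\<lambda>k. 1 / real (Suc k) < q - p) sequentially"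
      using order_tendstoD(2)[OF lim_1_over_n[THEN LIMSEQ_Suc], of "q - p"] p(2) by simp
    show "eventually (\<lambda>k. g k t < q) sequentially"
      using e0 e1 e2
    proof eventually_elim
      case (elim k)
      have "h k t \<le> p" unfolding h_def
      proof (rule cSUP_least[OF K(2)])
        fix s assume s: "s \<in> K"
        show "vk k s - real k * dist t s \<le> p"
        \<comment> \<open>Points near \<open>t\<close> have values below \<open>p\<close> by upper
          semicontinuity; for the others the penalty \<open>k * d\<close> exceeds
          \<open>M0 - p\<close>, hence outweighs the global bound \<open>M0\<close>.\<close>
        proof (cases "dist s t < d")
          case True
          then have "ereal (vk k s) \<le> ereal p"
            unfolding vk[OF s] using d(2)[OF s True] elim(1) by (simp add: less_imp_le)
          then show ?thesis by (smt (verit) ereal_less_eq(3) mult_nonneg_nonneg of_nat_0_le_iff zero_le_dist)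
        next
          case False
          have "M0 - p \<le> real k * d" using elim(2) d(1) by (simp add: field_simps)
          also have "\<dots> \<le> real k * dist t s" using False by (intro mult_left_mono) (auto simp: dist_commute)
          finally show ?thesis using vkM[OF s, of k] by simp
        qed
      qed
      then show ?case using elim(3) by (simp add: g_def)
    qed
  next
    fix k t show "g k t \<le> M0 + 1" using hM[of k t] by (simp add: g_def add_mono)
  qed (use M0 in auto)
qed

lemma usc_on_interval_measurable:
  assumes "usc_on {a..b::real} V"
  shows "(\<lambda>t. if t \<in> {a..b} then V t else 0) \<in> borel_measurable borel"
proof (rule borel_measurableI_less)
  fix c
  obtain T where T: "open T" "{z \<in> {a..b}. V z < c} = {a..b} \<inter> T"
    using assms by (metis usc_on_def openin_open)
  have "{x. (if x \<in> {a..b} then V x else 0) < c} = ({a..b} \<inter> T) \<union> (- {a..b} \<inter> {x. 0 < c})"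
    unfolding T(2)[symmetric] by auto
  also have "\<dots> \<in> sets borel" using T(1) by auto
  finally show "{x \<in> space borel. (if x \<in> {a..b} then V x else 0) < c} \<in> sets borel" by simp
qed

text \<open>The converse of \<open>circle_mean_le\<close>: the mean of an upper semicontinuous
  function is the infimum of the means of its continuous strict majorants. Only this form is used to
  establish submean inequalities, so such a proof starts from a continuous \<open>g\<close> with a
  known integral.\<close>

lemma le_circle_mean:
  assumes usc: "usc_on {0..2*pi} (\<lambda>t. v (a + of_real r * cis t))"
    and fin: "\<And>t. t \<in> {0..2*pi} \<Longrightarrow> v (a + of_real r * cis t) < \<infinity>"
    and maj: "\<And>g m. continuous_on UNIV g \<Longrightarrow> (g has_integral 2*pi*m) {0..2*pi} \<Longrightarrow>
        (\<And>t. t \<in> {0..2*pi} \<Longrightarrow> v (a + of_real r * cis t) < ereal (g t)) \<Longrightarrow> L \<le> ereal m"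
  shows "L \<le> circle_mean v a r"
proof (cases L)
  case MInf then show ?thesis by simp
next
  let ?I = "{0..2*pi}"
  define V where "V t = v (a + of_real r * cis t)" for t
  have ne: "?I \<noteq> {}" by simp
  have uscV: "usc_on ?I V" using usc by (simp add: V_def[abs_def])
  have finV: "V t < \<infinity>" if "t \<in> ?I" for t using fin[OF that] by (simp only: V_def)
  obtain g M where g: "\<And>k. continuous_on UNIV (g k)" "\<And>k t. t \<in> ?I \<Longrightarrow> V t < ereal (g k t)"
    "\<And>t q. t \<in> ?I \<Longrightarrow> V t < ereal q \<Longrightarrow> eventually (\<lambda>k. g k t < q) sequentially"
    "\<And>k t. g k t \<le> M" "0 \<le> M"
    using usc_continuous_majorants[OF compact_Icc ne uscV finV] by metis
  define m where "m k = integral ?I (g k) / (2*pi)" for k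
  have cont: "continuous_on ?I (g k)" for k using g(1) continuous_on_subset by blast
  have int: "(g k has_integral 2*pi*m k) ?I" for k
    unfolding m_def using integrable_integral[OF integrable_continuous_real[OF cont]] by simp
  have Lm: "L \<le> ereal (m k)" for k
    using maj[OF g(1)[of k] int[of k]] g(2)[of _ k] by (simp add: V_def)
  {
    case PInf then show ?thesis using Lm by auto
  next
    case (real l)
    have lm: "l \<le> m k" for k using Lm real by simp
    have Vless: "V t \<le> ereal M" if "t \<in> ?I" for t using g(2)[OF that] g(4)[of 0 t]
      by (meson ereal_less_eq(3) less_imp_le order_trans)
    define V0 where "V0 t = (if t \<in> ?I then V t else 0)" for t
    have meas[measurable]: "V0 \<in> borel_measurable borel"
      unfolding V0_def by (rule usc_on_interval_measurable[OF uscV])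
    let ?F = "\<integral>\<^sup>+t. e2ennreal (ereal M - V0 t) * indicator ?I t \<partial>lborel"
    let ?P = "\<integral>\<^sup>+t. e2ennreal (V0 t) * indicator ?I t \<partial>lborel"
    let ?N = "\<integral>\<^sup>+t. e2ennreal (- V0 t) * indicator ?I t \<partial>lborel"
    have nn: "(\<integral>\<^sup>+t. ennreal (M - g k t) * indicator ?I t \<partial>lborel) = ennreal (2*pi*(M - m k))" for k
    proof -
      have "((\<lambda>t. M - g k t) has_integral 2*pi*(M - m k)) ?I"
        using has_integral_diff[OF has_integral_const_real[of M 0 "2*pi"] int[of k]] by (simp add: algebra_simps)
      from nn_integral_has_integral_lebesgue'[OF _ this] g(4) show ?thesis
        by (simp add: algebra_simps)
    qed
    \<comment> \<open>Fatou's lemma for the functions \<open>M - g k\<close>, which are nonnegative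
      because \<open>M\<close> bounds every majorant; the third property of the majorants says that
      their lower limit dominates \<open>M - V\<close>.\<close>
    have "?F \<le> (\<integral>\<^sup>+t. liminf (\<lambda>k. ennreal (M - g k t) * indicator ?I t) \<partial>lborel)"
    proof (rule nn_integral_mono)
      fix t
      show "e2ennreal (ereal M - V0 t) * indicator ?I t \<le> liminf (\<lambda>k. ennreal (M - g k t) * indicator ?I t)"
      proof (cases "t \<in> ?I")
        case True
        have "e2ennreal (ereal M - V t) \<le> liminf (\<lambda>k. ennreal (M - g k t))"
          unfolding le_Liminf_iff
        proof (intro allI impI)
          fix y assume y: "y < e2ennreal (ereal M - V t)"
          then obtain c where c: "y = ennreal c" "0 \<le> c" by (cases y) auto
          have "ereal c < ereal M - V t"
            using y c by (metis e2ennreal_ereal e2ennreal_mono not_le)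
          then have "V t < ereal (M - c)" by (cases "V t") auto
          from g(3)[OF True this] show "eventually (\<lambda>k. y < ennreal (M - g k t)) sequentially"
            by eventually_elim (use c in \<open>auto simp: ennreal_less_iff\<close>)
        qed
        then show ?thesis using True by (simp add: V0_def)
      qed simp
    qed
    also have "\<dots> \<le> liminf (\<lambda>k. \<integral>\<^sup>+t. ennreal (M - g k t) * indicator ?I t \<partial>lborel)"
      by (rule nn_integral_liminf) (use borel_measurable_continuous_onI[OF g(1)] in measurable)
    also have "\<dots> \<le> liminf (\<lambda>k. ennreal (2*pi*(M - l)))"
      unfolding nn using lm by (intro Liminf_mono always_eventually allI ennreal_leI mult_left_mono) auto
    also have "\<dots> = ennreal (2*pi*(M - l))" by (simp add: Liminf_const)
    finally have F: "?F \<le> ennreal (2*pi*(M - l))" .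
    \<comment> \<open>The identity \<open>(M - V) + V^+ = M + V^-\<close> in nonnegative quantities:
      it stays valid where \<open>V\<close> is \<open>-\<infinity>\<close> and postpones subtraction
      until all integrals are known to be finite.\<close>
    have "?F + ?P = (\<integral>\<^sup>+t. ennreal M * indicator ?I t \<partial>lborel) + ?N"
    proof -
      have *: "e2ennreal (ereal M - V0 t) * indicator ?I t + e2ennreal (V0 t) * indicator ?I t
         = ennreal M * indicator ?I t + e2ennreal (- V0 t) * indicator ?I t" for t
      proof (cases "t \<in> ?I")
        case True
        have "e2ennreal (ereal M - V t) + e2ennreal (V t) = ennreal M + e2ennreal (- V t)"
        proof (cases "V t")
          case (real x)
          have "x \<le> M" using Vless[OF True] real by simp
          then show ?thesis using real g(5) by (cases "x \<ge> 0") (auto simp: ennreal_plus[symmetric] ennreal_neg simp del: ennreal_plus)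
        next
          case MInf then show ?thesis by (simp add: e2ennreal_neg)
        qed (use Vless[OF True] in auto)
        then show ?thesis using True by (simp add: V0_def)
      qed (auto simp: V0_def)
      show ?thesis
        by (subst (1 2) nn_integral_add[symmetric]) (auto simp: *)
    qed
    moreover have "(\<integral>\<^sup>+t. ennreal M * indicator ?I t \<partial>lborel) = ennreal (2*pi*M)"
      using g(5) by (simp add: nn_integral_cmult_indicator ennreal_mult'[symmetric] mult_ac)
    ultimately have eq: "?F + ?P = ennreal (2*pi*M) + ?N" by simp
    have "?P \<le> (\<integral>\<^sup>+t. ennreal M * indicator ?I t \<partial>lborel)"
    proof (rule nn_integral_mono)
      fix t show "e2ennreal (V0 t) * indicator ?I t \<le> ennreal M * indicator ?I t"
        using Vless[of t] by (auto simp: V0_def split: split_indicator) (metis e2ennreal_ereal e2ennreal_mono)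
    qed
    also have "\<dots> = ennreal (2*pi*M)"
      using g(5) by (simp add: nn_integral_cmult_indicator ennreal_mult'[symmetric] mult_ac)
    finally have "?P \<noteq> top" by (auto simp: top_unique)
    then obtain p where p: "?P = ennreal p" "0 \<le> p" by (cases ?P) auto
    have "?N \<noteq> top" using eq F p by (metis ennreal_add_eq_top ennreal_neq_top top_unique)
    then obtain n where n: "?N = ennreal n" "0 \<le> n" by (cases ?N) auto
    have "l \<le> M" using lm[of 0] int[of 0] has_integral_le[OF int[of 0] has_integral_const_real[of M 0 "2*pi"]] g(4)
      by auto
    have "ennreal (2*pi*M + n) \<le> ennreal (2*pi*(M-l) + p)"
    proof -
      have "ennreal (2*pi*M + n) = ?F + ?P" unfolding eq n(1) using g(5) n(2) by (simp add: ennreal_plus)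
      also have "\<dots> \<le> ennreal (2*pi*(M-l)) + ennreal p" unfolding p(1) using F by (rule add_right_mono)
      also have "\<dots> = ennreal (2*pi*(M-l) + p)" using \<open>l \<le> M\<close> p(2) by (simp add: ennreal_plus)
      finally show ?thesis .
    qed
    then have "2*pi*M + n \<le> 2*pi*(M-l) + p"
      using \<open>l \<le> M\<close> p by (subst (asm) ennreal_le_iff) auto
    then have "l \<le> 1/(2*pi) * (p - n)" by (simp add: field_simps)
    moreover have "circle_mean v a r = ereal (1/(2*pi)) * (enn2ereal ?P - enn2ereal ?N)"
      unfolding circle_mean_def
      by (intro arg_cong2[of _ _ _ _ "\<lambda>x y. ereal (1/(2*pi)) * (enn2ereal x - enn2ereal y)"] nn_integral_cong)
        (auto simp: V0_def V_def split: split_indicator)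
    ultimately show ?thesis using real p n by simp
  }
qed


section \<open>Subharmonic functions with a logarithmic pole\<close>

text \<open>
  The maximum principle for \<open>\<phi> - (1 - \<epsilon>) log |z| - Re f + \<eta> |z|\<^sup>2\<close>: the term with \<open>\<epsilon>\<close> controls the
  puncture, and the one with \<open>\<eta>\<close> makes the submean inequality strict, so that an interior maximum
  is impossible. On each circle about \<open>a\<close>, \<open>|z|\<^sup>2\<close> is the real part of a holomorphic function.
\<close>

lemma subharmonic_log_pole_le_aux:
  assumes sub: "subharmonic_on U \<phi>" "cball 0 1 \<subseteq> U"
    and pole: "\<forall>\<^sub>F \<zeta> in at 0. \<phi> \<zeta> \<le> ereal (ln (norm \<zeta>) + C)"
    and f: "f holomorphic_on UNIV"
    and bd: "\<And>\<zeta>. norm \<zeta> = 1 \<Longrightarrow> \<phi> \<zeta> \<le> ereal (Re (f \<zeta>))"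
    and z0: "z0 \<noteq> 0" "norm z0 \<le> 1" and \<epsilon>: "0 < \<epsilon>" "\<epsilon> < 1"
  shows "\<phi> z0 \<le> ereal ((1 - \<epsilon>) * ln (norm z0) + Re (f z0))"
proof (rule ccontr)
  assume neg: "\<not> ?thesis"
  define b where "b z = (1 - \<epsilon>) * ln (norm z) + Re (f z)" for z
  have "ereal (b z0) < \<phi> z0" using neg by (simp add: b_def)
  then obtain q' where q': "ereal (b z0) < ereal q'" "ereal q' < \<phi> z0" using ereal_dense2 by blast
  \<comment> \<open>Part of the gap by which the claim is assumed to fail. The weight
    \<open>\<eta> * ((norm z)^2 - 1)\<close> vanishes on the unit circle and is at least
    \<open>-\<eta>\<close> inside, so \<open>\<psi>\<close> is at most 0 on that circle but still
    positive at \<open>z0\<close>.\<close>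
  define \<eta> where "\<eta> = q' - b z0"
  have \<eta>: "0 < \<eta>" "ereal (b z0 + \<eta>) < \<phi> z0" using q' by (auto simp: \<eta>_def)
  define \<psi> where "\<psi> z = \<phi> z + ereal (\<eta> * ((norm z)\<^sup>2 - 1) - b z)" for z
  have "0 \<le> \<eta> * (norm z0)\<^sup>2" using \<eta>(1) by simp
  then have \<psi>z0: "0 < \<psi> z0"
    using \<eta>(2) by (cases "\<phi> z0") (auto simp: \<psi>_def algebra_simps)
  have contf: "continuous_on S f" for S
    using f holomorphic_on_imp_continuous_on continuous_on_subset by blast
  have "compact ((\<lambda>z. Re (f z)) ` cball 0 1)"
    by (intro compact_continuous_image continuous_intros contf compact_cball)
  then obtain B where "\<forall>x\<in>(\<lambda>z. Re (f z)) ` cball 0 1. norm x \<le> B"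
    unfolding bounded_iff[symmetric] using compact_imp_bounded by (metis bounded_iff)
  then have B: "\<bar>Re (f z)\<bar> \<le> B" if "norm z \<le> 1" for z
    using that by simp
  obtain d where d: "d > 0" "\<And>z. z \<noteq> 0 \<Longrightarrow> norm z < d \<Longrightarrow> \<phi> z \<le> ereal (ln (norm z) + C)"
    using pole unfolding eventually_at by auto
  \<comment> \<open>Radius of the inner boundary circle. There \<open>\<phi>\<close> is at most
    \<open>ln s + C\<close>, while \<open>b\<close> is at least
    \<open>(1 - \<epsilon>) * ln s - B\<close>; the exponential makes the surplus
    \<open>\<epsilon> * ln s\<close> absorb \<open>C + B\<close>. The last term of the minimum keeps
    \<open>z0\<close> in the annulus.\<close>
  define s where "s = min (d/2) (min (exp (- (C + B) / \<epsilon>)) (norm z0))"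
  have s: "0 < s" "s < d" "s \<le> norm z0" "s \<le> 1" "\<epsilon> * ln s \<le> - (C + B)"
  proof -
    show s0: "0 < s" "s < d" "s \<le> norm z0" "s \<le> 1" using d(1) z0 by (auto simp: s_def)
    have "ln s \<le> ln (exp (- (C + B) / \<epsilon>))" using s0(1) by (subst ln_le_cancel_iff) (auto simp: s_def)
    then show "\<epsilon> * ln s \<le> - (C + B)" using \<epsilon>(1) by (simp add: field_simps)
  qed
  define A where "A = cball (0::complex) 1 - ball 0 s"
  have A: "z \<in> A \<longleftrightarrow> s \<le> norm z \<and> norm z \<le> 1" for z by (auto simp: A_def)
  have nz: "z \<noteq> 0" if "z \<in> A" for z using that s(1) by (auto simp: A)
  have contb: "continuous_on A b"
    unfolding b_def by (intro continuous_intros contf) (auto simp: nz)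
  have "usc_on A \<psi>"
    unfolding \<psi>_def
  proof (rule usc_on_add_continuous)
    show "usc_on A \<phi>"
    proof (rule usc_on_subset)
      show "usc_on U \<phi>" using sub(1) by (simp add: subharmonic_on_def)
      show "A \<subseteq> U" using sub(2) by (auto simp: A_def)
    qed
    show "continuous_on A (\<lambda>x. \<eta> * ((norm x)\<^sup>2 - 1) - b x)"
      by (intro continuous_intros contb)
  qed
  moreover have "compact A" "z0 \<in> A" using z0 s by (auto simp: A) (simp add: A_def compact_diff)
  ultimately obtain a where a: "a \<in> A" "\<And>z. z \<in> A \<Longrightarrow> \<psi> z \<le> \<psi> a"
    using usc_attains_max[of A \<psi>] by blast
  have \<psi>a: "0 < \<psi> a" using \<psi>z0 a(2)[OF \<open>z0 \<in> A\<close>] by simp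
  have "norm a \<noteq> 1"
  proof
    assume "norm a = 1"
    with bd[of a] \<psi>a show False by (cases "\<phi> a") (auto simp: \<psi>_def b_def)
  qed
  moreover have "norm a \<noteq> s"
  proof
    assume n: "norm a = s"
    have "\<phi> a \<le> ereal (ln s + C)" using d(2)[of a] nz[OF a(1)] s n by simp
    then have "\<psi> a \<le> ereal (ln s + C + (\<eta> * (s\<^sup>2 - 1) - b a))"
      unfolding \<psi>_def n by (cases "\<phi> a") auto
    moreover have "ln s + C + (\<eta> * (s\<^sup>2 - 1) - b a) \<le> 0"
    proof -
      have "\<bar>Re (f a)\<bar> \<le> B" using B[of a] a(1) by (simp add: A)
      moreover have "\<eta> * (s\<^sup>2 - 1) \<le> 0" using \<eta>(1) s by (simp add: mult_le_0_iff power_le_one)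
      ultimately show ?thesis using s(5) n by (simp add: b_def algebra_simps)
    qed
    ultimately have "\<psi> a \<le> ereal 0" by (meson ereal_less_eq(3) order_trans)
    then show False using \<psi>a by (simp add: zero_ereal_def)
  qed
  ultimately have na: "s < norm a" "norm a < 1" using a(1) by (auto simp: A)
  define \<rho> where "\<rho> = min (norm a - s) (1 - norm a)"
  have \<rho>: "0 < \<rho>" "\<rho> < norm a" using na s(1) by (auto simp: \<rho>_def)
  have inA: "z \<in> A" if "z \<in> cball a \<rho>" for z
  proof -
    have "\<bar>norm a - norm z\<bar> \<le> \<rho>" using that norm_triangle_ineq3[of a z] by (simp add: dist_norm)
    then show ?thesis by (auto simp: A \<rho>_def)
  qed
  obtain x where x: "\<phi> a = ereal x"
  proof (cases "\<phi> a")
    case PInf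
    have "\<phi> a < \<infinity>" using sub a(1) by (auto simp: subharmonic_on_def A subset_iff)
    with PInf show ?thesis by simp
  qed (use \<psi>a in \<open>auto simp: \<psi>_def\<close>)
  \<comment> \<open>On the circle of radius \<open>\<rho>\<close> about \<open>a\<close>,
    \<open>Re H\<close> is precisely the bound on \<open>\<phi>\<close> that follows from
    \<open>\<psi> \<le> \<psi> a\<close>: \<open>ln (norm z)\<close> becomes
    \<open>ln (norm a) + Re (Ln (z / a))\<close>, and \<open>(norm z)^2\<close> becomes
    \<open>(norm a)^2 + \<rho>^2 + 2 * Re (cnj a * (z - a))\<close>. Since
    \<open>\<rho> < norm a\<close>, the quotient \<open>z / a\<close> stays in the right half-plane
    and \<open>H\<close> is holomorphic. At the centre only \<open>x - \<eta> * \<rho>^2\<close>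
    remains, which is less than \<open>\<phi> a\<close>.\<close>
  define H where "H z = of_real (x - b a - \<eta> * \<rho>\<^sup>2 + (1 - \<epsilon>) * ln (norm a)) + (1 - \<epsilon>) * Ln (z / a) + f z
      - of_real \<eta> * (2 * cnj a * (z - a))" for z
  have a0: "a \<noteq> 0" using nz a by blast
  have pos: "0 < Re (z / a)" if "z \<in> cball a \<rho>" for z
  proof -
    have "norm (z / a - 1) = norm (z - a) / norm a" using a0 by (simp add: norm_divide[symmetric] diff_divide_distrib)
    also have "\<dots> < 1" using that \<rho> a0 by (simp add: dist_norm norm_minus_commute field_simps)
    finally show ?thesis using abs_Re_le_cmod[of "z/a - 1"] by simp
  qed
  have Hhol: "H holomorphic_on cball a \<rho>"
    unfolding H_def
  proof (intro holomorphic_intros)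
    show "f holomorphic_on cball a \<rho>" using f holomorphic_on_subset by blast
    show "z / a \<notin> \<real>\<^sub>\<le>\<^sub>0" if "z \<in> cball a \<rho>" for z
      using pos[OF that] by (auto simp: complex_nonpos_Reals_iff)
  qed (use a0 in auto)
  have Hint: "((\<lambda>t. Re (H (a + of_real \<rho> * cis t))) has_integral 2*pi * Re (H a)) {0..2*pi}"
    by (rule Re_holomorphic_has_integral_circle)
      (use Hhol \<rho> in \<open>auto intro: holomorphic_on_imp_continuous_on holomorphic_on_subset\<close>)
  have circ: "a + of_real \<rho> * cis t \<in> cball a \<rho>" for t using \<rho> by (simp add: dist_norm norm_mult)
  have "circle_mean \<phi> a \<rho> \<le> ereal (Re (H a))"
  proof (rule circle_mean_le[OF _ Hint])
    show "continuous_on {0..2*pi} (\<lambda>t. Re (H (a + of_real \<rho> * cis t)))"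
      by (intro continuous_intros continuous_on_compose2[OF holomorphic_on_imp_continuous_on[OF Hhol]])
        (use circ in auto)
    fix t
    define z where "z = a + of_real \<rho> * cis t"
    have zA: "z \<in> A" using inA circ by (simp add: z_def)
    have "norm (z / a) = norm z / norm a" by (simp add: norm_divide)
    then have lnz: "ln (norm z) = Re (Ln (z / a)) + ln (norm a)"
      using nz[OF zA] a0 by (simp add: ln_div)
    have n2: "(norm z)\<^sup>2 = (norm a)\<^sup>2 + \<rho>\<^sup>2 + 2 * Re (cnj a * (z - a))"
    proof -
      have "(norm z)\<^sup>2 = (norm a)\<^sup>2 + (norm (z - a))\<^sup>2 + 2 * Re (cnj a * (z - a))"
        unfolding cmod_power2 by (simp add: power2_eq_square algebra_simps)
      moreover have "norm (z - a) = \<rho>" using \<rho> by (simp add: z_def norm_mult)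
      ultimately show ?thesis by simp
    qed
    have "\<psi> z \<le> \<psi> a" using a(2)[OF zA] .
    then have "\<phi> z \<le> ereal (x + (\<eta> * (norm a)\<^sup>2 - b a) - (\<eta> * (norm z)\<^sup>2 - b z))"
      unfolding \<psi>_def x by (cases "\<phi> z") (auto simp: algebra_simps)
    also have "x + (\<eta> * (norm a)\<^sup>2 - b a) - (\<eta> * (norm z)\<^sup>2 - b z) = Re (H z)"
      unfolding n2 by (simp add: H_def b_def[of z] lnz algebra_simps)
    finally show "\<phi> (a + of_real \<rho> * cis t) \<le> ereal (Re (H (a + of_real \<rho> * cis t)))"
      by (simp add: z_def)
  qed
  moreover have "Re (H a) = x - \<eta> * \<rho>\<^sup>2" using a0 by (simp add: H_def b_def)
  moreover have "\<phi> a \<le> circle_mean \<phi> a \<rho>"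
  proof -
    have "cball a \<rho> \<subseteq> U" using inA sub(2) by (force simp: A)
    then show ?thesis using sub(1) \<rho>(1) by (simp add: subharmonic_on_def)
  qed
  ultimately have "ereal x \<le> ereal (x - \<eta> * \<rho>\<^sup>2)" using x by (metis order_trans)
  then show False using \<eta>(1) \<rho>(1) by (simp add: mult_le_0_iff)
qed

lemma subharmonic_log_pole_le:
  assumes "subharmonic_on U \<phi>" "cball 0 1 \<subseteq> U"
    and "\<forall>\<^sub>F \<zeta> in at 0. \<phi> \<zeta> \<le> ereal (ln (norm \<zeta>) + C)"
    and "f holomorphic_on UNIV"
    and "\<And>\<zeta>. norm \<zeta> = 1 \<Longrightarrow> \<phi> \<zeta> \<le> ereal (Re (f \<zeta>))"
    and z0: "z0 \<noteq> 0" "norm z0 \<le> 1"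
  shows "\<phi> z0 \<le> ereal (ln (norm z0) + Re (f z0))"
proof (cases "\<phi> z0")
  case (real x)
  have "((\<lambda>\<epsilon>. (1 - \<epsilon>) * ln (norm z0) + Re (f z0)) \<longlongrightarrow> (1 - 0) * ln (norm z0) + Re (f z0)) (at_right 0)"
    by (intro tendsto_intros)
  moreover have "eventually (\<lambda>\<epsilon>. x \<le> (1 - \<epsilon>) * ln (norm z0) + Re (f z0)) (at_right 0)"
    using subharmonic_log_pole_le_aux[OF assms] real
    by (auto simp: eventually_at_right_field intro!: exI[of _ 1])
  ultimately have "x \<le> (1 - 0) * ln (norm z0) + Re (f z0)"
    by (intro tendsto_lowerbound) auto
  then show ?thesis using real by simp
next
  case PInf
  have "\<phi> z0 \<le> ereal ((1 - 1/2) * ln (norm z0) + Re (f z0))"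
    by (rule subharmonic_log_pole_le_aux[OF assms]) auto
  with PInf show ?thesis by simp
qed simp

section \<open>Plurisubharmonicity of the logarithm of the norm\<close>

text \<open>Jensen's formula for a polynomial of degree at most one: the mean of
  \<open>ln (norm (A + B * cis t))\<close> is the larger of \<open>ln A\<close> and
  \<open>ln (norm B)\<close>. The strict majorant exceeds the modulus by a positive amount on the
  compact interval, which leaves room to perturb \<open>A\<close>.\<close>

lemma ln_le_mean_majorant:
  assumes g: "continuous_on {0..2*pi} g" "(g has_integral 2*pi*m) {0..2*pi}"
    and A: "0 < A"
    and less: "\<And>t. t \<in> {0..2*pi} \<Longrightarrow> norm (of_real A + B * cis t) < exp (g t)"
  shows "ln A \<le> m"
proof -
  let ?I = "{0..2*pi}"
  have "continuous_on ?I (\<lambda>t. exp (g t) - norm (of_real A + B * cis t))"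
    using g(1) by (intro continuous_intros)
  then obtain t0 where t0: "t0 \<in> ?I"
    "\<And>t. t \<in> ?I \<Longrightarrow> exp (g t0) - norm (of_real A + B * cis t0) \<le> exp (g t) - norm (of_real A + B * cis t)"
    using continuous_attains_inf[of ?I "\<lambda>t. exp (g t) - norm (of_real A + B * cis t)"] by auto
  define \<mu> where "\<mu> = exp (g t0) - norm (of_real A + B * cis t0)"
  have \<mu>: "0 < \<mu>" using less[OF t0(1)] by (simp add: \<mu>_def)
  text \<open>Moving \<^term>\<open>A\<close> away from \<open>norm B\<close> removes a zero from the circle.\<close>
  define A' where "A' = (if A = norm B then A + \<mu> / 2 else A)"
  have A': "A \<le> A'" "A' < A + \<mu>" "A' \<noteq> norm B" using \<mu> by (auto simp: A'_def)
  have less': "norm (of_real A' + B * cis t) < exp (g t)" if "t \<in> ?I" for t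
  proof -
    have "of_real A' + B * cis t = (of_real A + B * cis t) + of_real (A' - A)" by simp
    then have "norm (of_real A' + B * cis t) \<le> norm (of_real A + B * cis t) + \<bar>A' - A\<bar>"
      by (metis norm_of_real norm_triangle_ineq)
    then show ?thesis using t0(2)[OF that] A' unfolding \<mu>_def by simp
  qed
  have nz: "of_real A' + B * cis t \<noteq> 0" for t
  proof
    assume "of_real A' + B * cis t = 0"
    then have "norm (of_real A' :: complex) = norm (B * cis t)" by (metis add_eq_0_iff norm_minus_cancel)
    then show False using A' A by (simp add: norm_mult)
  qed
  have gless: "ln (norm (of_real A' + B * cis t)) \<le> g t" if "t \<in> ?I" for t
    using less'[OF that] nz[of t] by (metis less_imp_le ln_exp ln_le_cancel_iff zero_less_norm_iff exp_gt_zero)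
  have "\<exists>k. ln A' \<le> k \<and> ((\<lambda>t. ln (norm (of_real A' + B * cis t))) has_integral 2*pi*k) ?I"
  proof (cases "norm B < A'")
    case True
    have pos: "0 < Re (of_real A' + B * z)" if "z \<in> cball 0 1" for z
    proof -
      have "norm (B * z) < A'" using that True by (smt (verit) mult_left_le norm_ge_zero norm_mult mem_cball_0)
      then show ?thesis using abs_Re_le_cmod[of "B * z"] by simp
    qed
    have hol: "(\<lambda>z. Ln (of_real A' + B * z)) holomorphic_on cball 0 1"
      by (intro holomorphic_intros) (use pos in \<open>force simp: complex_nonpos_Reals_iff\<close>)
    have "((\<lambda>t. Re (Ln (of_real A' + B * (0 + of_real 1 * cis t)))) has_integral 2*pi*Re (Ln (of_real A' + B * 0))) ?I"
      by (rule Re_holomorphic_has_integral_circle)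
        (use hol in \<open>auto intro: holomorphic_on_imp_continuous_on holomorphic_on_subset\<close>)
    then have "((\<lambda>t. ln (norm (of_real A' + B * cis t))) has_integral 2*pi*ln A') ?I"
      using nz A A' by simp
    then show ?thesis by blast
  next
    case False
    then have B: "A' < norm B" "B \<noteq> 0" using A' A by auto
    \<comment> \<open>The zero now lies inside the disc. Conjugating \<open>A' + B * cis t\<close>
      and multiplying by \<open>cis t\<close> keeps the modulus and turns it into
      \<open>cnj B * (1 + A' * cis t / cnj B)\<close>, whose zero as a function of
      \<open>cis t\<close> is the reflected point outside the disc; its logarithm is
      holomorphic.\<close>
    have pos: "0 < Re (1 + of_real A' * z / cnj B)" if "z \<in> cball 0 1" for z
    proof -
      have "norm (of_real A' * z / cnj B) = A' * norm z / norm B" using A A' by (simp add: norm_mult norm_divide)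
      also have "\<dots> < 1" using that B A A' by (simp add: divide_less_eq) (smt (verit) mult_left_le)
      finally show ?thesis using abs_Re_le_cmod[of "of_real A' * z / cnj B"] by simp
    qed
    have hol: "(\<lambda>z. Ln (1 + of_real A' * z / cnj B) + of_real (ln (norm B))) holomorphic_on cball 0 1"
      by (intro holomorphic_intros) (use pos B in \<open>force simp: complex_nonpos_Reals_iff\<close>)+
    have int: "((\<lambda>t. Re (Ln (1 + of_real A' * (0 + of_real 1 * cis t) / cnj B) + of_real (ln (norm B))))
        has_integral 2*pi*Re (Ln (1 + of_real A' * 0 / cnj B) + of_real (ln (norm B)))) ?I"
      by (rule Re_holomorphic_has_integral_circle[where f = "\<lambda>z. Ln (1 + of_real A' * z / cnj B) + of_real (ln (norm B))"])
        (use hol in \<open>auto intro: holomorphic_on_imp_continuous_on holomorphic_on_subset\<close>)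
    have "((\<lambda>t. ln (norm (of_real A' + B * cis t))) has_integral 2*pi*ln (norm B)) ?I"
    proof (rule has_integral_eq[rotated])
      show "((\<lambda>t. Re (Ln (1 + of_real A' * cis t / cnj B) + of_real (ln (norm B)))) has_integral 2*pi*ln (norm B)) ?I"
        using int by simp
      fix t
      have "norm (of_real A' + B * cis t) = norm (cnj (of_real A' + B * cis t) * cis t)"
        by (simp only: norm_mult complex_mod_cnj norm_cis mult_1_right)
      also have "cnj (of_real A' + B * cis t) * cis t = (1 + of_real A' * cis t / cnj B) * cnj B"
        using B(2) by (simp add: field_simps cis_cnj cis_mult)
      finally have *: "norm (of_real A' + B * cis t) = norm (1 + of_real A' * cis t / cnj B) * norm B"
        by (simp only: norm_mult complex_mod_cnj)
      have "1 + of_real A' * cis t / cnj B \<noteq> 0" using pos[of "cis t"] by force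
      then show "Re (Ln (1 + of_real A' * cis t / cnj B) + of_real (ln (norm B))) = ln (norm (of_real A' + B * cis t))"
        using B(2) unfolding * by (simp add: ln_mult)
    qed
    moreover have "ln A' \<le> ln (norm B)" using B A A' by simp
    ultimately show ?thesis by blast
  qed
  then obtain k where k: "ln A' \<le> k" "((\<lambda>t. ln (norm (of_real A' + B * cis t))) has_integral 2*pi*k) ?I" by blast
  have "2*pi*k \<le> 2*pi*m" using has_integral_le[OF k(2) g(2) gless] .
  moreover have "ln A \<le> ln A'" using A A' by simp
  ultimately show ?thesis using k(1) by simp
qed

lemma norm_vector_scalar_mult: "norm (c *s X) = norm c * norm (X :: complex ^ 'n)"
  by (simp add: norm_vec_def norm_mult L2_set_right_distrib)

lemma continuous_on_vector_scalar_mult [continuous_intros]: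
  fixes X :: "'a::topological_space \<Rightarrow> complex ^ 'n"
  assumes "continuous_on S f" "continuous_on S X"
  shows "continuous_on S (\<lambda>x. f x *s X x)"
  unfolding vector_scalar_mult_def by (intro continuous_intros assms)

lemma usc_elog_norm: "usc_on S (\<lambda>z. elog (norm (f z)) + ereal c)" if "continuous_on S f"
  for f :: "'a::topological_space \<Rightarrow> 'b::real_normed_vector"
proof (rule usc_on_add_continuous)
  have "open {x::'b. elog (norm x) < b}" for b
  proof (cases b)
    case (real r)
    have "elog (norm x) < b \<longleftrightarrow> norm x < exp r" for x :: 'b
      using ln_less_cancel_iff[of "norm x" "exp r"] by (cases "x = 0") (auto simp: elog_def real)
    then show ?thesis by (simp add: open_Collect_less continuous_on_norm_id)
  next
    case PInf
    then have "elog (norm x) < b" for x :: 'b by (simp add: elog_def)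
    then show ?thesis by simp
  qed simp
  then have "usc_on UNIV (\<lambda>x::'b. elog (norm x))" by (simp add: usc_on_open_iff)
  from usc_on_compose[OF this that] show "usc_on S (\<lambda>z. elog (norm (f z)))" by simp
qed (rule continuous_on_const)

text \<open>Reduction to one complex variable by the linear functional \<open>h\<close> of norm at
  most one that attains \<open>norm y\<close> at the centre \<open>y\<close>: along the line,
  \<open>h\<close> is \<open>norm y + B * cis t\<close>, its modulus bounds the vector norm from
  below, and \<open>ln_le_mean_majorant\<close> applies. If \<open>y = 0\<close>, the left-hand side
  is \<open>-\<infinity>\<close>.\<close>

lemma psh_on_log_norm:
  fixes w :: "complex ^ 'n"
  shows "psh_on \<Omega> (\<lambda>z. elog (norm (z - w)) + ereal c)"
  unfolding psh_on_def subharmonic_on_def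
proof (intro conjI allI ballI impI)
  show "usc_on \<Omega> (\<lambda>z. elog (norm (z - w)) + ereal c)"
    by (intro usc_elog_norm continuous_intros)
  have fin: "elog (norm (z - w)) + ereal c < \<infinity>" for z by (simp add: elog_def)
  show "elog (norm (z - w)) + ereal c < \<infinity>" for z by (rule fin)
  fix a X
  show "usc_on {\<zeta>. a + \<zeta> *s X \<in> \<Omega>} (\<lambda>\<zeta>. elog (norm (a + \<zeta> *s X - w)) + ereal c)"
    by (intro usc_elog_norm continuous_intros)
  show "elog (norm (a + \<zeta> *s X - w)) + ereal c < \<infinity>" for \<zeta> by (rule fin)
  fix \<alpha> :: complex and r :: real
  show "elog (norm (a + \<alpha> *s X - w)) + ereal c \<le> circle_mean (\<lambda>\<zeta>. elog (norm (a + \<zeta> *s X - w)) + ereal c) \<alpha> r"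
  proof (rule le_circle_mean)
    show "usc_on {0..2*pi} (\<lambda>t. elog (norm (a + (\<alpha> + of_real r * cis t) *s X - w)) + ereal c)"
      by (intro usc_elog_norm continuous_intros)
    show "elog (norm (a + (\<alpha> + of_real r * cis t) *s X - w)) + ereal c < \<infinity>" for t by (rule fin)
    fix g m
    assume g: "continuous_on UNIV g" "(g has_integral 2*pi*m) {0..2*pi}"
      and less: "\<And>t. t \<in> {0..2*pi} \<Longrightarrow> elog (norm (a + (\<alpha> + of_real r * cis t) *s X - w)) + ereal c < ereal (g t)"
    define y where "y = a + \<alpha> *s X - w"
    show "elog (norm (a + \<alpha> *s X - w)) + ereal c \<le> ereal m"
    proof (cases "y = 0")
      case False
      define e where "e i = cnj (y $ i) / of_real (norm y)" for i
      define h where "h v = (\<Sum>i\<in>UNIV. e i * v $ i)" for v :: "complex ^ 'n"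
      have hle: "norm (h v) \<le> norm v" for v
      proof -
        have "norm (h v) \<le> (\<Sum>i\<in>UNIV. \<bar>norm (e i)\<bar> * \<bar>norm (v $ i)\<bar>)"
          unfolding h_def by (rule order_trans[OF norm_sum]) (simp add: norm_mult)
        also have "\<dots> \<le> L2_set (\<lambda>i. norm (e i)) UNIV * L2_set (\<lambda>i. norm (v $ i)) UNIV"
          by (rule L2_set_mult_ineq)
        also have "L2_set (\<lambda>i. norm (e i)) UNIV = L2_set (\<lambda>i. inverse (norm y) * norm (y $ i)) UNIV"
          by (simp add: e_def norm_divide norm_inverse norm_mult divide_inverse mult.commute)
        also have "\<dots> = inverse (norm y) * norm y"
          unfolding norm_vec_def by (rule L2_set_right_distrib[symmetric]) (simp add: L2_set_nonneg)
        also have "L2_set (\<lambda>i. norm (v $ i)) UNIV = norm v" by (simp add: norm_vec_def)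
        finally show ?thesis using False by simp
      qed
      have "(\<Sum>i\<in>UNIV. cnj (y $ i) * y $ i) = of_real (\<Sum>i\<in>UNIV. (norm (y $ i))\<^sup>2)"
        by (simp add: complex_norm_square mult.commute del: of_real_power)
      also have "(\<Sum>i\<in>UNIV. (norm (y $ i))\<^sup>2) = (norm y)\<^sup>2"
        unfolding norm_vec_def L2_set_def by (simp add: sum_nonneg)
      finally have hy: "h y = of_real (norm y)"
        using False by (simp add: h_def e_def sum_divide_distrib[symmetric] power2_eq_square)
      have hlin: "h (y + (of_real r * cis t) *s X) = of_real (norm y) + (of_real r * h X) * cis t" for t
        unfolding hy[symmetric] by (simp add: h_def algebra_simps sum.distrib sum_distrib_left)
      have "ln (norm y) \<le> m - c"
      proof (rule ln_le_mean_majorant[where g = "\<lambda>t. g t - c" and B = "of_real r * h X"])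
        show "continuous_on {0..2*pi} (\<lambda>t. g t - c)"
          by (intro continuous_intros continuous_on_subset[OF g(1)]) auto
        show "((\<lambda>t. g t - c) has_integral 2*pi*(m - c)) {0..2*pi}"
          using has_integral_diff[OF g(2) has_integral_const_real[of c 0 "2*pi"]] by (simp add: algebra_simps)
        show "0 < norm y" using False by simp
        fix t :: real assume t: "t \<in> {0..2*pi}"
        let ?v = "y + (of_real r * cis t) *s X"
        have eq: "a + (\<alpha> + of_real r * cis t) *s X - w = ?v"
          by (simp add: y_def vec_eq_iff algebra_simps)
        have "norm ?v < exp (g t - c)"
        proof (cases "?v = 0")
          case False
          then have "ln (norm ?v) + c < g t" using less[OF t] unfolding eq by (simp add: elog_def)
          then have "exp (ln (norm ?v)) < exp (g t - c)" by simp
          then show ?thesis using False by simp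
        qed simp
        with hle[of ?v] show "norm (of_real (norm y) + (of_real r * h X) * cis t) < exp (g t - c)"
          unfolding hlin by simp
      qed
      then show ?thesis using False by (simp add: y_def[symmetric] elog_def)
    qed (simp add: y_def[symmetric] elog_def)
  qed
qed


section \<open>The Green function is plurisubharmonic\<close>

text \<open>The maximum principle on the disc \<open>\<zeta> \<mapsto> w + \<zeta> *s X\<close>. The
  constant \<open>C\<close> of the pole disappears from the conclusion: a bound on the boundary
  circle alone governs the whole punctured disc.\<close>

lemma psh_on_line_log_pole_le:
  assumes u: "psh_on \<Omega> u"
    and pole: "\<forall>\<^sub>F z in nhds w. u z \<le> elog (norm (z - w)) + ereal C"
    and disc: "\<And>\<zeta>. norm \<zeta> \<le> 1 \<Longrightarrow> w + \<zeta> *s X \<in> \<Omega>"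
    and f: "f holomorphic_on UNIV"
    and bd: "\<And>\<zeta>. norm \<zeta> = 1 \<Longrightarrow> u (w + \<zeta> *s X) \<le> ereal (Re (f \<zeta>))"
    and \<zeta>: "\<zeta> \<noteq> 0" "norm \<zeta> \<le> 1"
  shows "u (w + \<zeta> *s X) \<le> ereal (ln (norm \<zeta>) + Re (f \<zeta>))"
proof (rule subharmonic_log_pole_le[where \<phi> = "\<lambda>\<zeta>. u (w + \<zeta> *s X)"])
  show "subharmonic_on {\<zeta>. w + \<zeta> *s X \<in> \<Omega>} (\<lambda>\<zeta>. u (w + \<zeta> *s X))"
    using u by (simp add: psh_on_def)
  show "cball 0 1 \<subseteq> {\<zeta>. w + \<zeta> *s X \<in> \<Omega>}" using disc by auto
  have "continuous_on UNIV (\<lambda>\<zeta>. w + \<zeta> *s X)" by (intro continuous_intros)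
  then have "((\<lambda>\<zeta>. w + \<zeta> *s X) \<longlongrightarrow> w + 0 *s X) (at 0)"
    using continuous_on_eq_continuous_at[OF open_UNIV] isCont_def by blast
  then have "filterlim (\<lambda>\<zeta>. w + \<zeta> *s X) (nhds w) (at 0)" by simp
  from eventually_compose_filterlim[OF pole this]
  have "\<forall>\<^sub>F \<zeta> in at 0. u (w + \<zeta> *s X) \<le> elog (norm (\<zeta> *s X)) + ereal C" by simp
  moreover have "\<forall>\<^sub>F \<zeta> in at 0. \<zeta> \<noteq> (0::complex)" by (rule eventually_neq_at_within)
  \<comment> \<open>For \<open>X = 0\<close> the disc degenerates to the pole, where
    \<open>u\<close> is \<open>-\<infinity>\<close>, so the constant chosen there is
    arbitrary.\<close>
  ultimately show "\<forall>\<^sub>F \<zeta> in at 0. u (w + \<zeta> *s X) \<le> ereal (ln (norm \<zeta>) + (if X = 0 then 0 else ln (norm X) + C))"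
  proof eventually_elim
    case (elim \<zeta>)
    then show ?case by (auto simp: elog_def norm_vector_scalar_mult ln_mult add.assoc split: if_splits)
  qed
qed (use assms in auto)

text \<open>A Schwarz lemma: on the complex line through \<open>w\<close> and \<open>z\<close>,
  scaled so that the unit disc reaches the boundary of the ball, \<open>u\<close> is negative on the
  unit circle. The resulting constant \<open>- ln r\<close> is the same for all competitors, so that
  the supremum and its regularization keep the logarithmic pole.\<close>

lemma green_family_le:
  fixes w :: "complex ^ 'n"
  assumes u: "u \<in> green_family \<Omega> w" and r: "0 < r" "cball w r \<subseteq> \<Omega>" and z: "z \<in> cball w r"
  shows "u z \<le> elog (norm (z - w)) + ereal (- ln r)"
proof -
  obtain C :: real where u': "psh_on \<Omega> u" "\<And>z. z \<in> \<Omega> \<Longrightarrow> u z < 0"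
    "\<forall>\<^sub>F z in nhds w. u z \<le> elog (norm (z - w)) + ereal C"
    using u by (auto simp: green_family_def)
  show ?thesis
  proof (cases "z = w")
    case True
    then show ?thesis using eventually_nhds_x_imp_x[OF u'(3)] by (simp add: elog_def)
  next
    case False
    define X where "X = of_real (r / norm (z - w)) *s (z - w)"
    define \<zeta> :: complex where "\<zeta> = of_real (norm (z - w) / r)"
    have nX: "norm X = r" unfolding X_def norm_vector_scalar_mult using False r(1) by (simp add: norm_divide)
    have z\<zeta>: "w + \<zeta> *s X = z" using False r(1) by (simp add: X_def \<zeta>_def vector_smult_assoc del: vector_ssub_ldistrib)
    have disc: "w + \<xi> *s X \<in> \<Omega>" if "norm \<xi> \<le> 1" for \<xi>
      using r that by (intro subsetD[OF r(2)]) (simp add: dist_norm norm_vector_scalar_mult nX mult_left_le_one_le)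
    have "u (w + \<zeta> *s X) \<le> ereal (ln (norm \<zeta>) + Re ((\<lambda>_. 0) \<zeta>))"
    proof (rule psh_on_line_log_pole_le[OF u'(1,3) disc])
      show "u (w + \<xi> *s X) \<le> ereal (Re 0)" if "norm \<xi> = 1" for \<xi>
        using u'(2)[OF disc[of \<xi>]] that by (simp add: zero_ereal_def[symmetric] less_imp_le)
      show "norm \<zeta> \<le> 1" using z r(1) by (simp add: \<zeta>_def norm_divide dist_norm norm_minus_commute)
      show "\<zeta> \<noteq> 0" using False r(1) by (simp add: \<zeta>_def)
    qed auto
    then show ?thesis using False r(1) unfolding z\<zeta> by (simp add: \<zeta>_def elog_def norm_divide ln_div)
  qed
qed

lemma green_le:
  fixes w :: "complex ^ 'n"
  assumes "0 < r" "cball w r \<subseteq> \<Omega>" "z \<in> cball w r"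
  shows "green \<Omega> w z \<le> elog (norm (z - w)) + ereal (- ln r)"
  unfolding green_def by (rule SUP_least) (rule green_family_le[OF _ assms])

text \<open>The competitor is \<open>log (norm (z - w) / R)\<close>. This lower bound later confines
  the rescaled sublevel sets and the Azukawa sublevel sets to balls, and so supplies the dominating
  function and finiteness of measures.\<close>

lemma le_green:
  fixes w :: "complex ^ 'n"
  assumes R: "0 < R" "\<Omega> \<subseteq> ball w R" and z: "z \<in> \<Omega>"
  shows "elog (norm (z - w)) + ereal (- ln R) \<le> green \<Omega> w z"
proof -
  have "elog (norm (y - w)) + ereal (- ln R) < 0" if "y \<in> \<Omega>" for y
    using that R by (auto simp: elog_def dist_norm norm_minus_commute subset_iff)
  then have "(\<lambda>z. elog (norm (z - w)) + ereal (- ln R)) \<in> green_family \<Omega> w"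
    by (auto simp: green_family_def psh_on_log_norm intro!: exI[of _ "- ln R"])
  then show ?thesis unfolding green_def by (rule SUP_upper)
qed

text \<open>The upper semicontinuous regularization, the value at \<open>z\<close> itself included
  when \<open>z\<close> lies in \<open>S\<close>. Off the closure of \<open>S\<close> the innermost
  supremum is eventually over the empty set, hence \<open>-\<infinity>\<close>; this makes the
  function upper semicontinuous on the whole space.\<close>

definition usc_reg :: "'a::metric_space set \<Rightarrow> ('a \<Rightarrow> ereal) \<Rightarrow> 'a \<Rightarrow> ereal" where
  "usc_reg S u z = (INF d\<in>{0<..}. SUP y\<in>S \<inter> ball z d. u y)"

lemma usc_reg_usc: "usc_on UNIV (usc_reg S u)"
  unfolding usc_on_open_iff[OF open_UNIV]
proof
  fix c
  show "open {z \<in> UNIV. usc_reg S u z < c}"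
    unfolding open_contains_ball
  proof
    fix z assume "z \<in> {z \<in> UNIV. usc_reg S u z < c}"
    then obtain d where d: "0 < d" "(SUP y\<in>S \<inter> ball z d. u y) < c"
      by (auto simp: usc_reg_def INF_less_iff)
    have "usc_reg S u y < c" if y: "y \<in> ball z (d/2)" for y
    proof -
      have "ball y (d/2) \<subseteq> ball z d"
      proof
        fix x assume "x \<in> ball y (d/2)"
        then have "dist z x < d/2 + d/2" using y dist_triangle[of z x y] by simp
        then show "x \<in> ball z d" by simp
      qed
      then have "(SUP x\<in>S \<inter> ball y (d/2). u x) \<le> (SUP y\<in>S \<inter> ball z d. u y)"
        by (intro SUP_subset_mono) auto
      moreover have "usc_reg S u y \<le> (SUP x\<in>S \<inter> ball y (d/2). u x)"
        unfolding usc_reg_def using d(1) by (intro INF_lower) auto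
      ultimately show ?thesis using d(2) by (meson le_less_trans order_trans)
    qed
    then show "\<exists>e>0. ball z e \<subseteq> {z \<in> UNIV. usc_reg S u z < c}"
      using d(1) by (intro exI[of _ "d/2"]) auto
  qed
qed

lemma usc_reg_upper: "z \<in> S \<Longrightarrow> u z \<le> usc_reg S u z"
  unfolding usc_reg_def by (rule INF_greatest, rule SUP_upper) auto

lemma usc_reg_le:
  assumes "open T" "z \<in> T" "\<And>y. y \<in> S \<inter> T \<Longrightarrow> u y \<le> c"
  shows "usc_reg S u z \<le> c"
proof -
  obtain d where d: "0 < d" "ball z d \<subseteq> T" using assms(1,2) open_contains_ball by blast
  have "(SUP y\<in>S \<inter> ball z d. u y) \<le> c" using d(2) assms(3) by (intro SUP_least) auto
  then show ?thesis unfolding usc_reg_def using d(1) by (intro INF_lower2[of d]) auto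
qed

lemma usc_reg_le_usc:
  assumes "open T" "z \<in> T" "usc_on T h" "\<And>y. y \<in> S \<inter> T \<Longrightarrow> u y \<le> h y"
  shows "usc_reg S u z \<le> h z"
proof (rule dense_ge)
  fix c assume "h z < c"
  have "open {y \<in> T. h y < c}" using assms(1,3) by (simp add: usc_on_open_iff)
  then show "usc_reg S u z \<le> c"
    using \<open>h z < c\<close> assms(2,4) by (intro usc_reg_le[of "{y \<in> T. h y < c}"]) (auto intro: order_trans less_imp_le)
qed

text \<open>The value of \<open>G\<close> at a centre \<open>b\<close> involves \<open>u y\<close>
  for all \<open>y\<close> near \<open>b\<close>, so one majorant must serve all nearby circles. If
  \<open>g\<close> lies strictly above \<open>G\<close> on the circle about \<open>b\<close>, then
  by upper semicontinuity and compactness it also does so on the translated circles about nearby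
  \<open>y\<close>, which remain in \<open>\<Omega>\<close>. The submean inequality of each
  \<open>u\<close> at \<open>y\<close> then gives the common bound \<open>m\<close>, and this
  survives the supremum and the regularization.\<close>

lemma psh_on_usc_reg_SUP:
  fixes F :: "(complex ^ 'n \<Rightarrow> ereal) set"
  assumes "open \<Omega>" and psh: "\<And>u. u \<in> F \<Longrightarrow> psh_on \<Omega> u"
    and le: "\<And>u z. u \<in> F \<Longrightarrow> z \<in> \<Omega> \<Longrightarrow> u z \<le> ereal M"
  defines "G \<equiv> usc_reg \<Omega> (\<lambda>z. SUP u\<in>F. u z)"
  shows "psh_on \<Omega> G"
proof -
  have usc: "usc_on UNIV G" unfolding G_def by (rule usc_reg_usc)
  have uG: "u z \<le> G z" if "u \<in> F" "z \<in> \<Omega>" for u z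
    unfolding G_def by (rule order_trans[OF SUP_upper[OF that(1)] usc_reg_upper[OF that(2)]])
  have fin: "G z < \<infinity>" if "z \<in> \<Omega>" for z
  proof -
    have "G z \<le> ereal M" unfolding G_def
      by (rule usc_reg_le[OF \<open>open \<Omega>\<close> that]) (auto intro: SUP_least le)
    then show ?thesis by auto
  qed
  have cont: "continuous_on S (\<lambda>\<zeta>. a + \<zeta> *s X)" for a X :: "complex ^ 'n" and S
    by (intro continuous_intros)
  show ?thesis
    unfolding psh_on_def subharmonic_on_def
  proof (intro conjI allI ballI impI)
    show "usc_on \<Omega> G" using usc usc_on_subset by blast
    show "G z < \<infinity>" if "z \<in> \<Omega>" for z using fin[OF that] .
    fix a X
    show "usc_on {\<zeta>. a + \<zeta> *s X \<in> \<Omega>} (\<lambda>\<zeta>. G (a + \<zeta> *s X))"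
      by (rule usc_on_compose[OF usc cont]) simp
    show "G (a + \<zeta> *s X) < \<infinity>" if "\<zeta> \<in> {\<zeta>. a + \<zeta> *s X \<in> \<Omega>}" for \<zeta> using fin that by simp
    fix \<alpha> r assume r: "0 < r \<and> cball \<alpha> r \<subseteq> {\<zeta>. a + \<zeta> *s X \<in> \<Omega>}"
    have on: "a + (\<alpha> + of_real r * cis t) *s X \<in> \<Omega>" for t
    proof -
      have "\<alpha> + of_real r * cis t \<in> cball \<alpha> r" using r by (simp add: dist_norm norm_mult)
      then show ?thesis using r by blast
    qed
    show "G (a + \<alpha> *s X) \<le> circle_mean (\<lambda>\<zeta>. G (a + \<zeta> *s X)) \<alpha> r"
    proof (rule le_circle_mean)
      show "usc_on {0..2*pi} (\<lambda>t. G (a + (\<alpha> + of_real r * cis t) *s X))"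
        by (rule usc_on_compose[OF usc]) (auto intro!: continuous_intros)
      show "G (a + (\<alpha> + of_real r * cis t) *s X) < \<infinity>" for t using fin on by blast
      fix g m
      assume g: "continuous_on UNIV g" "(g has_integral 2*pi*m) {0..2*pi}"
        and less: "\<And>t. t \<in> {0..2*pi} \<Longrightarrow> G (a + (\<alpha> + of_real r * cis t) *s X) < ereal (g t)"
      define b where "b = a + \<alpha> *s X"
      let ?W1 = "{p. fst p + snd p *s X \<in> \<Omega>}"
      have "open ?W1"
      proof -
        have "open ((\<lambda>p. fst p + snd p *s X) -` \<Omega>)"
          by (intro open_vimage \<open>open \<Omega>\<close> continuous_intros)
        then show ?thesis by (simp add: vimage_def)
      qed
      moreover have "{b} \<times> cball 0 r \<subseteq> ?W1"
      proof clarsimp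
        fix \<zeta> :: complex assume "norm \<zeta> \<le> r"
        then have "\<alpha> + \<zeta> \<in> cball \<alpha> r" by (simp add: dist_norm)
        then have "a + (\<alpha> + \<zeta>) *s X \<in> \<Omega>" using r by blast
        then show "b + \<zeta> *s X \<in> \<Omega>" by (simp add: b_def vector_sadd_rdistrib add.assoc)
      qed
      ultimately have "\<exists>Y. b \<in> Y \<and> open Y \<and> Y \<times> cball 0 r \<subseteq> ?W1"
        by (intro Elementary_Topology.tube_lemma compact_cball)
      then obtain X1 where X1: "b \<in> X1" "open X1" "X1 \<times> cball 0 r \<subseteq> ?W1" by blast
      let ?W2 = "{p. G (fst p + (of_real r * cis (snd p)) *s X) + ereal (- g (snd p)) < 0}"
      have "usc_on UNIV (\<lambda>p. G (fst p + (of_real r * cis (snd p)) *s X) + ereal (- g (snd p)))"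
        by (intro usc_on_add_continuous usc_on_compose[OF usc])
          (auto intro!: continuous_intros continuous_on_compose2[OF g(1)])
      then have "open ?W2" by (simp add: usc_on_open_iff)
      moreover have "{b} \<times> {0..2*pi} \<subseteq> ?W2"
      proof clarsimp
        fix t assume t: "0 \<le> t" "t \<le> 2*pi"
        have "b + (of_real r * cis t) *s X = a + (\<alpha> + of_real r * cis t) *s X"
          by (simp add: b_def vector_sadd_rdistrib add.assoc)
        then have "G (b + (of_real r * cis t) *s X) < ereal (g t)" using less[of t] t by (simp only: atLeastAtMost_iff)
        then show "G (b + (of_real r * cis t) *s X) + ereal (- g t) < 0"
          by (cases "G (b + (of_real r * cis t) *s X)") auto
      qed
      ultimately have "\<exists>Y. b \<in> Y \<and> open Y \<and> Y \<times> {0..2*pi} \<subseteq> ?W2"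
        by (intro Elementary_Topology.tube_lemma compact_Icc)
      then obtain X2 where X2: "b \<in> X2" "open X2" "X2 \<times> {0..2*pi} \<subseteq> ?W2" by blast
      have "u y \<le> ereal m" if u: "u \<in> F" and y: "y \<in> X1" "y \<in> X2" for u y
      proof -
        have disc: "y + \<zeta> *s X \<in> \<Omega>" if "norm \<zeta> \<le> r" for \<zeta> using subsetD[OF X1(3), of "(y, \<zeta>)"] y(1) that by simp
        have "subharmonic_on {\<zeta>. y + \<zeta> *s X \<in> \<Omega>} (\<lambda>\<zeta>. u (y + \<zeta> *s X))"
          using psh[OF u] by (simp add: psh_on_def)
        moreover have "cball 0 r \<subseteq> {\<zeta>. y + \<zeta> *s X \<in> \<Omega>}" using disc by auto
        ultimately have "u (y + 0 *s X) \<le> circle_mean (\<lambda>\<zeta>. u (y + \<zeta> *s X)) 0 r"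
          using r unfolding subharmonic_on_def by blast
        also have "\<dots> \<le> ereal m"
        proof (rule circle_mean_le[OF _ g(2)])
          show "continuous_on {0..2*pi} g" using g(1) continuous_on_subset by blast
          fix t :: real assume t: "t \<in> {0..2*pi}"
          have "G (y + (of_real r * cis t) *s X) + ereal (- g t) < 0" using subsetD[OF X2(3), of "(y, t)"] y(2) t by simp
          moreover have "u (y + (of_real r * cis t) *s X) \<le> G (y + (of_real r * cis t) *s X)"
            using r by (intro uG[OF u] disc) (simp add: norm_mult)
          ultimately show "u (y + (0 + of_real r * cis t) *s X) \<le> ereal (g t)"
            by (cases "G (y + (of_real r * cis t) *s X)"; cases "u (y + (of_real r * cis t) *s X)") auto
        qed
        finally show ?thesis by simp
      qed
      then show "G (a + \<alpha> *s X) \<le> ereal m"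
        unfolding G_def b_def[symmetric] using X1(1,2) X2(1,2)
        by (intro usc_reg_le[of "X1 \<inter> X2"]) (auto intro!: SUP_least)
    qed
  qed
qed

lemma psh_on_add_const:
  assumes "psh_on \<Omega> u"
  shows "psh_on \<Omega> (\<lambda>z. u z + ereal c)"
  unfolding psh_on_def subharmonic_on_def
proof (intro conjI allI ballI impI)
  show "usc_on \<Omega> (\<lambda>z. u z + ereal c)"
    using assms by (intro usc_on_add_continuous) (auto simp: psh_on_def)
  have fin: "u z + ereal c < \<infinity>" if "z \<in> \<Omega>" for z
    using assms that by (cases "u z") (auto simp: psh_on_def)
  then show "u z + ereal c < \<infinity>" if "z \<in> \<Omega>" for z using that .
  fix a X
  have sub: "subharmonic_on {\<zeta>. a + \<zeta> *s X \<in> \<Omega>} (\<lambda>\<zeta>. u (a + \<zeta> *s X))"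
    using assms by (simp add: psh_on_def)
  then show usc: "usc_on {\<zeta>. a + \<zeta> *s X \<in> \<Omega>} (\<lambda>\<zeta>. u (a + \<zeta> *s X) + ereal c)"
    by (intro usc_on_add_continuous) (auto simp: subharmonic_on_def)
  show "u (a + \<zeta> *s X) + ereal c < \<infinity>" if "\<zeta> \<in> {\<zeta>. a + \<zeta> *s X \<in> \<Omega>}" for \<zeta> using fin that by simp
  fix \<alpha> r assume r: "0 < r \<and> cball \<alpha> r \<subseteq> {\<zeta>. a + \<zeta> *s X \<in> \<Omega>}"
  have on: "\<alpha> + of_real r * cis t \<in> {\<zeta>. a + \<zeta> *s X \<in> \<Omega>}" for t
  proof (rule subsetD)
    show "cball \<alpha> r \<subseteq> {\<zeta>. a + \<zeta> *s X \<in> \<Omega>}" using r by blast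
    show "\<alpha> + of_real r * cis t \<in> cball \<alpha> r" using r by (simp add: dist_norm norm_mult)
  qed
  show "u (a + \<alpha> *s X) + ereal c \<le> circle_mean (\<lambda>\<zeta>. u (a + \<zeta> *s X) + ereal c) \<alpha> r"
  proof (rule le_circle_mean)
    show "usc_on {0..2*pi} (\<lambda>t. u (a + (\<alpha> + of_real r * cis t) *s X) + ereal c)"
      by (rule usc_on_compose[OF usc, of _ "\<lambda>t. \<alpha> + of_real r * cis t"])
        (use on in \<open>auto intro!: continuous_intros\<close>)
    show "u (a + (\<alpha> + of_real r * cis t) *s X) + ereal c < \<infinity>" for t using fin on by blast
    fix g m
    assume g: "continuous_on UNIV g" "(g has_integral 2*pi*m) {0..2*pi}"
      and less: "\<And>t. t \<in> {0..2*pi} \<Longrightarrow> u (a + (\<alpha> + of_real r * cis t) *s X) + ereal c < ereal (g t)"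
    have "u (a + \<alpha> *s X) \<le> circle_mean (\<lambda>\<zeta>. u (a + \<zeta> *s X)) \<alpha> r"
      using sub r by (simp add: subharmonic_on_def)
    also have "\<dots> \<le> ereal (m - c)"
    proof (rule circle_mean_le)
      show "continuous_on {0..2*pi} (\<lambda>t. g t - c)"
        by (intro continuous_intros continuous_on_subset[OF g(1)]) auto
      show "((\<lambda>t. g t - c) has_integral 2*pi*(m - c)) {0..2*pi}"
        using has_integral_diff[OF g(2) has_integral_const_real[of c 0 "2*pi"]] by (simp add: algebra_simps)
      show "u (a + (\<alpha> + of_real r * cis t) *s X) \<le> ereal (g t - c)" if "t \<in> {0..2*pi}" for t
        using less[OF that] by (cases "u (a + (\<alpha> + of_real r * cis t) *s X)") auto
    qed
    finally show "u (a + \<alpha> *s X) + ereal c \<le> ereal m" by (cases "u (a + \<alpha> *s X)") auto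
  qed
qed

lemma psh_on_cong:
  assumes eq: "\<And>z. z \<in> \<Omega> \<Longrightarrow> u z = v z" and "psh_on \<Omega> u"
  shows "psh_on \<Omega> v"
proof -
  have usc: "usc_on S f \<longleftrightarrow> usc_on S g" if "\<And>x. x \<in> S \<Longrightarrow> f x = g x" for S :: "'b::topological_space set" and f g
  proof -
    have "{x \<in> S. f x < c} = {x \<in> S. g x < c}" for c using that by auto
    then show ?thesis by (simp add: usc_on_def)
  qed
  have mean: "circle_mean (\<lambda>\<zeta>. u (a + \<zeta> *s X)) \<alpha> r = circle_mean (\<lambda>\<zeta>. v (a + \<zeta> *s X)) \<alpha> r"
    if r: "0 < r" "cball \<alpha> r \<subseteq> {\<zeta>. a + \<zeta> *s X \<in> \<Omega>}" for a X \<alpha> r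
  proof -
    have "\<alpha> + of_real r * cis t \<in> {\<zeta>. a + \<zeta> *s X \<in> \<Omega>}" for t
      by (rule subsetD[OF r(2)]) (use r(1) in \<open>simp add: dist_norm norm_mult\<close>)
    then have "u (a + (\<alpha> + of_real r * cis t) *s X) = v (a + (\<alpha> + of_real r * cis t) *s X)" for t
      using eq by blast
    then show ?thesis by (simp only: circle_mean_def)
  qed
  have cent: "a + \<alpha> *s X \<in> \<Omega>" if "0 < r" "cball \<alpha> r \<subseteq> {\<zeta>. a + \<zeta> *s X \<in> \<Omega>}" for a X \<alpha> r
    using subsetD[OF that(2), of \<alpha>] that(1) by simp
  have "subharmonic_on {\<zeta>. a + \<zeta> *s X \<in> \<Omega>} (\<lambda>\<zeta>. v (a + \<zeta> *s X))" for a X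
  proof -
    have "subharmonic_on {\<zeta>. a + \<zeta> *s X \<in> \<Omega>} (\<lambda>\<zeta>. u (a + \<zeta> *s X))" using assms(2) by (simp add: psh_on_def)
    moreover have "usc_on {\<zeta>. a + \<zeta> *s X \<in> \<Omega>} (\<lambda>\<zeta>. u (a + \<zeta> *s X)) \<longleftrightarrow> usc_on {\<zeta>. a + \<zeta> *s X \<in> \<Omega>} (\<lambda>\<zeta>. v (a + \<zeta> *s X))"
      by (rule usc) (use eq in auto)
    ultimately show ?thesis unfolding subharmonic_on_def using mean cent eq by (metis mem_Collect_eq)
  qed
  moreover have "usc_on \<Omega> v" using assms(2) usc[of \<Omega> u v] eq by (simp add: psh_on_def)
  ultimately show ?thesis using assms(2) eq by (simp add: psh_on_def)
qed

text \<open>The regularization inherits the uniform pole bound and nonpositivity; subtracting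
  \<open>\<delta> > 0\<close> makes it strictly negative and hence a competitor. As
  \<open>\<delta>\<close> tends to 0, the Green function is seen to equal its
  regularization.\<close>

lemma psh_on_green:
  fixes w :: "complex ^ 'n"
  assumes "open \<Omega>" "w \<in> \<Omega>"
  shows "psh_on \<Omega> (green \<Omega> w)"
proof -
  define G where "G = usc_reg \<Omega> (green \<Omega> w)"
  have le0: "u z \<le> ereal 0" if "u \<in> green_family \<Omega> w" "z \<in> \<Omega>" for u z
    using that by (auto simp: green_family_def zero_ereal_def[symmetric] less_imp_le)
  have pshG: "psh_on \<Omega> G"
    using psh_on_usc_reg_SUP[OF assms(1), of "green_family \<Omega> w" 0] le0
    by (auto simp: G_def green_def[abs_def] green_family_def)
  have G0: "G z \<le> 0" if "z \<in> \<Omega>" for z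
    unfolding G_def using usc_reg_le[OF assms(1) that, of \<Omega> "green \<Omega> w" 0] le0
    by (auto simp: green_def zero_ereal_def[symmetric] intro: SUP_least)
  obtain r where r: "0 < r" "cball w r \<subseteq> \<Omega>"
    using assms open_contains_cball by blast
  have pole: "G z \<le> elog (norm (z - w)) + ereal (- ln r)" if "z \<in> ball w r" for z
    unfolding G_def
    by (rule usc_reg_le_usc[OF open_ball that, where h = "\<lambda>z. elog (norm (z - w)) + ereal (- ln r)"])
      (auto intro!: usc_elog_norm continuous_intros green_le[OF r])
  have "G z = green \<Omega> w z" if z: "z \<in> \<Omega>" for z
  proof (rule antisym)
    show "green \<Omega> w z \<le> G z" unfolding G_def by (rule usc_reg_upper[OF z])
    show "G z \<le> green \<Omega> w z"
    proof (rule ereal_le_epsilon2)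
      fix \<delta> :: real assume \<delta>: "0 < \<delta>"
      have "(\<lambda>z. G z + ereal (- \<delta>)) \<in> green_family \<Omega> w"
        unfolding green_family_def
      proof (intro CollectI conjI ballI exI)
        show "psh_on \<Omega> (\<lambda>z. G z + ereal (- \<delta>))" by (rule psh_on_add_const[OF pshG])
        show "G y + ereal (- \<delta>) < 0" if "y \<in> \<Omega>" for y
          using G0[OF that] \<delta> by (cases "G y") auto
        have "\<forall>\<^sub>F z in nhds w. z \<in> ball w r" using r(1) by (intro eventually_nhds_in_open) auto
        then show "\<forall>\<^sub>F z in nhds w. G z + ereal (- \<delta>) \<le> elog (norm (z - w)) + ereal (- ln r - \<delta>)"
        proof eventually_elim
          case (elim z)
          from pole[OF elim] show ?case
            by (cases "G z"; cases "elog (norm (z - w))") auto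
        qed
      qed
      then have "G z + ereal (- \<delta>) \<le> green \<Omega> w z" unfolding green_def by (rule SUP_upper)
      then show "G z \<le> green \<Omega> w z + ereal \<delta>" by (cases "G z"; cases "green \<Omega> w z") auto
    qed
  qed
  then show ?thesis using psh_on_cong[OF _ pshG] by blast
qed


section \<open>Convergence in measure along complex lines\<close>

text \<open>On the unit circle \<open>cnj \<zeta>\<close> is \<open>1 / \<zeta>\<close>, so
  polynomials in the real and imaginary parts are Laurent polynomials; the factor
  \<open>\<zeta> ^ n\<close> clears the negative powers.\<close>

lemma real_polynomial_function_circle:
  fixes g :: "complex \<Rightarrow> real"
  assumes "real_polynomial_function g"
  shows "\<exists>n p. \<forall>\<zeta>. norm \<zeta> = 1 \<longrightarrow> of_real (g \<zeta>) * \<zeta> ^ n = poly p \<zeta>"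
  using assms
proof induction
  case (linear f)
  interpret bounded_linear f by fact
  \<comment> \<open>The coefficients come from \<open>Re \<zeta> = (\<zeta> + 1/\<zeta>) / 2\<close>
    and \<open>Im \<zeta> = (\<zeta> - 1/\<zeta>) / (2 * \<i>)\<close>, multiplied by
    \<open>\<zeta>\<close>.\<close>
  have "of_real (f \<zeta>) * \<zeta> ^ 1 =
      poly [: of_real (f 1) / 2 - of_real (f \<i>) / (2 * \<i>), 0, of_real (f 1) / 2 + of_real (f \<i>) / (2 * \<i>) :] \<zeta>"
    if "norm \<zeta> = 1" for \<zeta>
  proof -
    have "f \<zeta> = f (Re \<zeta> *\<^sub>R 1 + Im \<zeta> *\<^sub>R \<i>)" by (rule arg_cong[of _ _ f]) (simp add: complex_eq_iff)
    then have f: "f \<zeta> = Re \<zeta> * f 1 + Im \<zeta> * f \<i>" by (simp only: add scaleR real_scaleR_def)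
    have 1: "\<zeta> * cnj \<zeta> = 1" using that by (simp add: complex_norm_square[symmetric])
    have ReIm: "of_real (Re \<zeta>) = (\<zeta> + cnj \<zeta>) / 2" "of_real (Im \<zeta>) = (\<zeta> - cnj \<zeta>) / (2 * \<i>)"
      by (simp_all add: complex_eq_iff)
    have sq: "of_real (Re \<zeta>) * \<zeta> = (\<zeta>\<^sup>2 + 1) / 2" "of_real (Im \<zeta>) * \<zeta> = (\<zeta>\<^sup>2 - 1) / (2 * \<i>)"
      unfolding ReIm 1[symmetric] by (simp_all add: power2_eq_square algebra_simps)
    have "of_real (f \<zeta>) * \<zeta> = of_real (f 1) * (of_real (Re \<zeta>) * \<zeta>) + of_real (f \<i>) * (of_real (Im \<zeta>) * \<zeta>)"
      unfolding f by (simp add: algebra_simps)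
    also have "\<dots> = of_real (f 1) * ((\<zeta>\<^sup>2 + 1) / 2) + of_real (f \<i>) * ((\<zeta>\<^sup>2 - 1) / (2 * \<i>))"
      by (simp only: sq)
    finally show ?thesis
      by (simp add: power2_eq_square algebra_simps add_divide_distrib diff_divide_distrib)
  qed
  then show ?case by blast
next
  case (const c)
  have "of_real c * \<zeta> ^ 0 = poly [:of_real c:] \<zeta>" for \<zeta> :: complex by simp
  then show ?case by blast
next
  case (add f g)
  then obtain n p m q where "\<And>\<zeta>. norm \<zeta> = 1 \<Longrightarrow> of_real (f \<zeta>) * \<zeta> ^ n = poly p \<zeta>"
    "\<And>\<zeta>. norm \<zeta> = 1 \<Longrightarrow> of_real (g \<zeta>) * \<zeta> ^ m = poly q \<zeta>" by blast
  then have "of_real (f \<zeta> + g \<zeta>) * \<zeta> ^ (n + m) = poly (p * monom 1 m + q * monom 1 n) \<zeta>" if "norm \<zeta> = 1" for \<zeta>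
    using that by (simp add: poly_monom power_add algebra_simps flip: \<open>\<And>\<zeta>. norm \<zeta> = 1 \<Longrightarrow> of_real (f \<zeta>) * \<zeta> ^ n = poly p \<zeta>\<close>)
  then show ?case by blast
next
  case (mult f g)
  then obtain n p m q where "\<And>\<zeta>. norm \<zeta> = 1 \<Longrightarrow> of_real (f \<zeta>) * \<zeta> ^ n = poly p \<zeta>"
    "\<And>\<zeta>. norm \<zeta> = 1 \<Longrightarrow> of_real (g \<zeta>) * \<zeta> ^ m = poly q \<zeta>" by blast
  then have "of_real (f \<zeta> * g \<zeta>) * \<zeta> ^ (n + m) = poly (p * q) \<zeta>" if "norm \<zeta> = 1" for \<zeta>
    using that by (simp add: power_add mult_ac flip: \<open>\<And>\<zeta>. norm \<zeta> = 1 \<Longrightarrow> of_real (f \<zeta>) * \<zeta> ^ n = poly p \<zeta>\<close>)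
  then show ?case by blast
qed

text \<open>Replaces the Poisson integral. After Weierstrass approximation by a Laurent polynomial,
  a term \<open>a * \<zeta> ^ (- j)\<close> has on the circle the same real part as its conjugate
  \<open>cnj a * \<zeta> ^ j\<close>, so all negative powers can be reflected into positive
  ones.\<close>

lemma continuous_circle_approx_Re_entire:
  fixes h :: "complex \<Rightarrow> real"
  assumes "continuous_on (sphere 0 1) h" "0 < e"
  obtains f where "f holomorphic_on UNIV" "\<And>\<zeta>. norm \<zeta> = 1 \<Longrightarrow> \<bar>h \<zeta> - Re (f \<zeta>)\<bar> < e"
proof -
  obtain g where g: "real_polynomial_function g" "\<And>\<zeta>. \<zeta> \<in> sphere 0 1 \<Longrightarrow> \<bar>h \<zeta> - g \<zeta>\<bar> < e"
    using Stone_Weierstrass_real_polynomial_function[OF compact_sphere assms] by blast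
  obtain n p where p: "\<And>\<zeta>. norm \<zeta> = 1 \<Longrightarrow> of_real (g \<zeta>) * \<zeta> ^ n = poly p \<zeta>"
    using real_polynomial_function_circle[OF g(1)] by blast
  define c where "c k \<zeta> = (if n \<le> k then coeff p k * \<zeta> ^ (k - n) else cnj (coeff p k) * \<zeta> ^ (n - k))" for k \<zeta>
  define f where "f \<zeta> = (\<Sum>k\<le>degree p. c k \<zeta>)" for \<zeta>
  have Re: "Re (f \<zeta>) = g \<zeta>" if \<zeta>: "norm \<zeta> = 1" for \<zeta>
  proof -
    have 1: "\<zeta> * cnj \<zeta> = 1" using \<zeta> by (simp add: complex_norm_square[symmetric])
    have 2: "\<zeta> ^ j * cnj \<zeta> ^ j = 1" for j using 1 by (simp flip: power_mult_distrib)
    have Rec: "Re (c k \<zeta>) = Re (coeff p k * \<zeta> ^ k * cnj \<zeta> ^ n)" for k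
    proof (cases "n \<le> k")
      case True
      then have "\<zeta> ^ k * cnj \<zeta> ^ n = \<zeta> ^ (k - n) * (\<zeta> ^ n * cnj \<zeta> ^ n)"
        by (simp add: mult.assoc[symmetric] flip: power_add)
      then show ?thesis using True by (simp add: c_def 2 mult.assoc)
    next
      case False
      then have "cnj \<zeta> ^ n = cnj \<zeta> ^ k * cnj \<zeta> ^ (n - k)" by (simp flip: power_add)
      then have "\<zeta> ^ k * cnj \<zeta> ^ n = (\<zeta> ^ k * cnj \<zeta> ^ k) * cnj \<zeta> ^ (n - k)" by (simp add: mult.assoc)
      then have "\<zeta> ^ k * cnj \<zeta> ^ n = cnj \<zeta> ^ (n - k)" by (simp add: 2)
      then have "coeff p k * \<zeta> ^ k * cnj \<zeta> ^ n = cnj (c k \<zeta>)" using False by (simp add: c_def mult.assoc)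
      then show ?thesis by simp
    qed
    have "of_real (g \<zeta>) = of_real (g \<zeta>) * \<zeta> ^ n * cnj \<zeta> ^ n" using 2[of n] by (simp add: mult.assoc)
    also have "\<dots> = (\<Sum>k\<le>degree p. coeff p k * \<zeta> ^ k * cnj \<zeta> ^ n)"
      unfolding p[OF \<zeta>] by (simp add: poly_altdef sum_distrib_right)
    finally have "g \<zeta> = Re (\<Sum>k\<le>degree p. coeff p k * \<zeta> ^ k * cnj \<zeta> ^ n)" by (metis Re_complex_of_real)
    then show ?thesis unfolding f_def Re_sum by (simp only: Rec)
  qed
  have "(\<lambda>\<zeta>. c k \<zeta>) holomorphic_on UNIV" for k
    unfolding c_def by (cases "n \<le> k") (auto intro!: holomorphic_intros)
  then have "f holomorphic_on UNIV" unfolding f_def by (intro holomorphic_on_sum)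
  then show ?thesis using that[of f] Re g(2) by auto
qed

section \<open>Logarithmic bounds on small discs and their improvement\<close>

text \<open>A finite certificate that the upper limit of
  \<open>u (w + \<zeta> *s X) - log |\<zeta>|\<close> is at most \<open>c\<close>. The logarithm
  stands on the right, so that nothing is subtracted from a possibly infinite value.\<close>

definition disc_bound :: "(complex ^ 'n) set \<Rightarrow> (complex ^ 'n \<Rightarrow> ereal) \<Rightarrow> complex ^ 'n \<Rightarrow> complex ^ 'n \<Rightarrow> real \<Rightarrow> real \<Rightarrow> bool" where
  "disc_bound \<Omega> u w X r c \<longleftrightarrow> (\<forall>\<zeta>. norm \<zeta> \<le> r \<longrightarrow> w + \<zeta> *s X \<in> \<Omega> \<and>
     (\<zeta> \<noteq> 0 \<longrightarrow> u (w + \<zeta> *s X) \<le> ereal (ln (norm \<zeta>) + c)))"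

lemma disc_bound_mono: "disc_bound \<Omega> u w X r c \<Longrightarrow> r' \<le> r \<Longrightarrow> c \<le> c' \<Longrightarrow> disc_bound \<Omega> u w X r' c'"
  unfolding disc_bound_def by (meson add_left_mono ereal_less_eq(3) order_trans)

text \<open>
  The Poisson estimate: on the circle of radius \<open>r\<close>, the function \<open>u - log |\<zeta>|\<close> is at most \<open>c\<close>,
  and negative on \<open>K\<close>; hence it is eventually at most the average \<open>c (1 - |K| / 2\<pi>)\<close> near the centre.
\<close>

lemma disc_bound_improve:
  assumes u: "psh_on \<Omega> u" and pole: "\<forall>\<^sub>F z in nhds w. u z \<le> elog (norm (z - w)) + ereal C"
    and db: "disc_bound \<Omega> u w X r c" and r: "0 < r" and c: "0 \<le> c"
    and K: "compact K" "K \<subseteq> {0..2*pi}"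
    and neg: "\<And>t. t \<in> K \<Longrightarrow> u (w + (of_real r * cis t) *s X) < ereal (ln r)"
    and e: "0 < e"
  shows "\<exists>r'>0. disc_bound \<Omega> u w X r' (c - c * measure lborel K / (2*pi) + e)"
proof -
  let ?S = "sphere 0 1 :: complex set"
  have on: "w + (of_real r * \<zeta>) *s X \<in> \<Omega>" if "norm \<zeta> \<le> 1" for \<zeta>
    using db that r unfolding disc_bound_def by (auto simp: norm_mult mult_left_le)
  \<comment> \<open>\<open>F\<close> is relatively open in the circle by upper semicontinuity, so
    the compact image of \<open>K\<close> and the complement of \<open>F\<close> can be separated by
    a continuous \<open>h\<close>. Then \<open>ln r + h\<close> majorizes \<open>u\<close>
    everywhere on the circle: on \<open>F\<close> because \<open>h\<close> is nonnegative, elsewhere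
    because \<open>h\<close> equals \<open>c\<close>.\<close>
  define F where "F = {\<zeta> \<in> ?S. u (w + (of_real r * \<zeta>) *s X) < ereal (ln r)}"
  have "usc_on ?S (\<lambda>\<zeta>. u (w + (of_real r * \<zeta>) *s X))"
    by (rule usc_on_compose[of \<Omega>]) (use u on in \<open>auto simp: psh_on_def intro!: continuous_intros\<close>)
  then have "openin (top_of_set ?S) F" by (simp add: usc_on_def F_def)
  then have "closedin (top_of_set ?S) (?S - F)" by (simp add: closedin_diff)
  moreover have "closedin (top_of_set ?S) (cis ` K)"
  proof (rule closed_subset)
    show "closed (cis ` K)"
      by (intro compact_imp_closed compact_continuous_image K continuous_intros)
  qed (auto)
  moreover have "cis ` K \<inter> (?S - F) = {}" using neg by (auto simp: F_def)
  ultimately obtain h :: "complex \<Rightarrow> real" where h: "continuous_on ?S h"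
    "\<And>x. x \<in> ?S \<Longrightarrow> h x \<in> closed_segment 0 c" "\<And>x. x \<in> cis ` K \<Longrightarrow> h x = 0" "\<And>x. x \<in> ?S - F \<Longrightarrow> h x = c"
    using Urysohn_local[of ?S "cis ` K" "?S - F" 0 c] by metis
  have h0c: "0 \<le> h x" "h x \<le> c" if "x \<in> ?S" for x
    using h(2)[OF that] c by (auto simp: closed_segment_eq_real_ivl)
  \<comment> \<open>The three thirds of \<open>e\<close> pay for raising \<open>Re f\<close> above
    \<open>h\<close>, for comparing the mean of \<open>Re f\<close> with that of \<open>h\<close>,
    and for the variation of \<open>Re f\<close> near 0.\<close>
  obtain f where f: "f holomorphic_on UNIV" "\<And>\<zeta>. norm \<zeta> = 1 \<Longrightarrow> \<bar>h \<zeta> - Re (f \<zeta>)\<bar> < e/3"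
    using continuous_circle_approx_Re_entire[OF h(1), of "e/3"] e by auto
  have contf: "continuous_on UNIV f" using f(1) holomorphic_on_imp_continuous_on by blast
  have bound: "u (w + \<zeta> *s (of_real r *s X)) \<le> ereal (ln (norm \<zeta>) + Re (f \<zeta> + of_real (ln r + e/3)))"
    if "\<zeta> \<noteq> 0" "norm \<zeta> \<le> 1" for \<zeta>
  proof (rule psh_on_line_log_pole_le[OF u pole _ _ _ that])
    show "w + \<zeta> *s (of_real r *s X) \<in> \<Omega>" if "norm \<zeta> \<le> 1" for \<zeta>
      using on[OF that] by (simp add: vector_smult_assoc mult.commute)
    show "(\<lambda>\<zeta>. f \<zeta> + of_real (ln r + e/3)) holomorphic_on UNIV" using f(1) by (intro holomorphic_intros)
    fix \<zeta> :: complex assume \<zeta>: "norm \<zeta> = 1"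
    have "u (w + (of_real r * \<zeta>) *s X) \<le> ereal (ln r + h \<zeta>)"
    proof (cases "\<zeta> \<in> F")
      case True
      then have "u (w + (of_real r * \<zeta>) *s X) \<le> ereal (ln r)" by (simp add: F_def less_imp_le)
      also have "\<dots> \<le> ereal (ln r + h \<zeta>)" using h0c[of \<zeta>] \<zeta> by simp
      finally show ?thesis .
    next
      case False
      then have "h \<zeta> = c" using h(4) \<zeta> by simp
      then show ?thesis using db \<zeta> r unfolding disc_bound_def by (auto simp: norm_mult dest!: spec[of _ "of_real r * \<zeta>"])
    qed
    also have "\<dots> \<le> ereal (Re (f \<zeta> + of_real (ln r + e/3)))"
    proof -
      have "h \<zeta> \<le> Re (f \<zeta>) + e/3" using f(2)[OF \<zeta>] by linarith
      then show ?thesis by simp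
    qed
    finally show "u (w + \<zeta> *s (of_real r *s X)) \<le> ereal (Re (f \<zeta> + of_real (ln r + e/3)))"
      by (simp add: vector_smult_assoc mult.commute)
  qed
  have Ref0: "Re (f 0) \<le> c - c * measure lborel K / (2*pi) + e/3"
  proof -
    have "((\<lambda>t. Re (f (0 + of_real 1 * cis t))) has_integral 2*pi * Re (f 0)) {0..2*pi}"
      by (rule Re_holomorphic_has_integral_circle)
        (use contf f(1) in \<open>auto intro: continuous_on_subset holomorphic_on_subset\<close>)
    then have i1: "((\<lambda>t. Re (f (cis t))) has_integral 2*pi * Re (f 0)) {0..2*pi}" by simp
    have "((\<lambda>x. 1) has_integral measure lborel K) K"
      using emeasure_compact_finite[OF K(1)] borel_compact[OF K(1)] by (intro has_integral_measure_lborel) auto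
    then have "((\<lambda>x. if x \<in> K then 1 else 0) has_integral measure lborel K) {0..2*pi}"
      using K(2) by (subst has_integral_restrict) auto
    from has_integral_diff[OF has_integral_const_real[of "c + e/3" 0 "2*pi"] has_integral_mult_right[OF this, of c]]
    have i2: "((\<lambda>t. c + e/3 - c * (if t \<in> K then 1 else 0)) has_integral 2*pi*(c + e/3) - c * measure lborel K) {0..2*pi}"
      by (simp add: algebra_simps)
    have "2*pi * Re (f 0) \<le> 2*pi*(c + e/3) - c * measure lborel K"
    proof (rule has_integral_le[OF i1 i2])
      fix t
      have "\<bar>h (cis t) - Re (f (cis t))\<bar> < e/3" by (intro f(2)) simp
      moreover have "h (cis t) \<le> c - c * (if t \<in> K then 1 else 0)"
        using h0c(2)[of "cis t"] h(3)[of "cis t"] by auto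
      ultimately show "Re (f (cis t)) \<le> c + e/3 - c * (if t \<in> K then 1 else 0)" by linarith
    qed
    then show ?thesis by (simp add: field_simps)
  qed
  have "((\<lambda>\<zeta>. Re (f \<zeta>)) \<longlongrightarrow> Re (f 0)) (at 0)"
    using contf continuous_on_eq_continuous_at[OF open_UNIV] by (intro tendsto_Re) (auto simp: isCont_def)
  then have "\<forall>\<^sub>F \<zeta> in at 0. Re (f \<zeta>) < Re (f 0) + e/3"
    using e by (intro order_tendstoD(2)) auto
  then obtain d where d: "d > 0" "\<And>\<zeta>. \<zeta> \<noteq> 0 \<Longrightarrow> norm \<zeta> < d \<Longrightarrow> Re (f \<zeta>) < Re (f 0) + e/3"
    unfolding eventually_at by auto
  define r' where "r' = r * min (d/2) 1"
  show ?thesis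
  proof (intro exI[of _ r'] conjI)
    show "0 < r'" using r d(1) by (simp add: r'_def)
    show "disc_bound \<Omega> u w X r' (c - c * measure lborel K / (2*pi) + e)"
      unfolding disc_bound_def
    proof (intro allI impI conjI)
      fix \<xi> :: complex assume \<xi>: "norm \<xi> \<le> r'"
      define \<zeta> where "\<zeta> = \<xi> / of_real r"
      have "norm \<zeta> \<le> min (d/2) 1"
        using \<xi> r by (simp only: \<zeta>_def r'_def norm_divide norm_of_real abs_of_pos pos_divide_le_eq mult.commute)
      then have \<zeta>: "norm \<zeta> \<le> 1" "norm \<zeta> < d" using d(1) by auto
      have \<xi>\<zeta>: "\<xi> = of_real r * \<zeta>" "norm \<xi> = r * norm \<zeta>" using r by (auto simp: \<zeta>_def norm_divide)
      show "w + \<xi> *s X \<in> \<Omega>" using on[OF \<zeta>(1)] \<xi>\<zeta>(1) by simp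
      assume "\<xi> \<noteq> 0"
      then have "\<zeta> \<noteq> 0" using \<xi>\<zeta>(1) by auto
      have "u (w + \<xi> *s X) \<le> ereal (ln (norm \<zeta>) + Re (f \<zeta> + of_real (ln r + e/3)))"
        using bound[OF \<open>\<zeta> \<noteq> 0\<close> \<zeta>(1)] by (simp add: \<xi>\<zeta>(1) vector_smult_assoc mult.commute)
      also have "\<dots> \<le> ereal (ln (norm \<xi>) + (c - c * measure lborel K / (2*pi) + e))"
        using d(2)[OF \<open>\<zeta> \<noteq> 0\<close> \<zeta>(2)] Ref0 r \<open>\<zeta> \<noteq> 0\<close> unfolding \<xi>\<zeta>(2) by (simp add: ln_mult)
      finally show "u (w + \<xi> *s X) \<le> ereal (ln (norm \<xi>) + (c - c * measure lborel K / (2*pi) + e))" .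
    qed
  qed
qed

text \<open>Let \<open>L\<close> be the set of constants valid on some disc; its infimum, at least
  \<open>s > 0\<close>, plays the role of \<open>A(X)\<close>. Take \<open>c\<close> in
  \<open>L\<close> within \<open>\<epsilon>\<close> of the infimum. A large set of angles with low
  values on any smaller circle would let \<open>disc_bound_improve\<close> produce an element of
  \<open>L\<close> below \<open>Inf L\<close>.\<close>

lemma sublevel_circle_measure_tendsto_0:
  assumes u: "psh_on \<Omega> u" and pole: "\<forall>\<^sub>F z in nhds w. u z \<le> elog (norm (z - w)) + ereal C"
    and db0: "disc_bound \<Omega> u w X r0 c0" "0 < r0"
    and s: "0 < s" "\<And>c r. 0 < r \<Longrightarrow> disc_bound \<Omega> u w X r c \<Longrightarrow> s \<le> c"
  shows "((\<lambda>r. emeasure lborel {t \<in> {0..2*pi}. u (w + (of_real r * cis t) *s X) < ereal (ln r)}) \<longlongrightarrow> 0) (at_right 0)"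
proof (rule tendsto_zero_ennreal)
  fix \<delta> :: real assume \<delta>: "0 < \<delta>"
  define L where "L = {c. \<exists>r>0. disc_bound \<Omega> u w X r c}"
  have L: "L \<noteq> {}" "bdd_below L" "\<And>c. c \<in> L \<Longrightarrow> s \<le> c"
    using db0 s(2) by (auto simp: L_def intro!: bdd_belowI[of _ s])
  \<comment> \<open>The infimum forces \<open>c * |K| / (2*pi) \<le> 2 * \<epsilon>\<close>, that is
    \<open>|K| \<le> \<delta> / 2\<close> because \<open>c \<ge> s\<close>. Together with the loss
    \<open>\<delta> / 4\<close> from the inner closed approximation \<open>K\<close> this stays
    below \<open>\<delta>\<close>.\<close>
  define \<epsilon> where "\<epsilon> = \<delta> * s / (8*pi)"
  have \<epsilon>: "0 < \<epsilon>" using \<delta> s(1) by (simp add: \<epsilon>_def)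
  obtain c where c: "c \<in> L" "c < Inf L + \<epsilon>" using \<epsilon> L(1) by (metis cInf_lessD less_add_same_cancel1)
  then obtain r1 where r1: "0 < r1" "disc_bound \<Omega> u w X r1 c" by (auto simp: L_def)
  have sc: "s \<le> c" using L(3) c(1) .
  have "emeasure lborel {t \<in> {0..2*pi}. u (w + (of_real r * cis t) *s X) < ereal (ln r)} < ennreal \<delta>"
    if r: "0 < r" "r < r1" for r
  proof -
    let ?V = "\<lambda>t. u (w + (of_real r * cis t) *s X)"
    let ?B = "{t \<in> {0..2*pi}. ?V t < ereal (ln r)}"
    have db: "disc_bound \<Omega> u w X r c" using disc_bound_mono[OF r1(2)] r by simp
    have "usc_on {0..2*pi} ?V"
      by (rule usc_on_compose[of \<Omega>])
        (use u db r in \<open>auto simp: psh_on_def disc_bound_def norm_mult intro!: continuous_intros\<close>)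
    then obtain T where "open T" "?B = {0..2*pi} \<inter> T"
      unfolding usc_on_def openin_open by blast
    then have B: "?B \<in> sets borel" by simp
    then have Bl: "?B \<in> sets lebesgue" by (intro sets_completionI_sets) simp
    have "0 < \<delta> / 4" using \<delta> by simp
    then obtain K where K: "closed K" "K \<subseteq> ?B" "emeasure lebesgue (?B - K) < ennreal (\<delta> / 4)"
      by (rule sets_lebesgue_inner_closed[OF Bl])
    have "K = {0..2*pi} \<inter> K" using K(2) by blast
    then have cK: "compact K" using compact_Int_closed[OF compact_Icc K(1), of 0 "2*pi"] by simp
    have "\<exists>r'>0. disc_bound \<Omega> u w X r' (c - c * measure lborel K / (2*pi) + \<epsilon>)"
      by (rule disc_bound_improve[OF u pole db]) (use r sc s(1) cK K(2) \<epsilon> in auto)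
    then have "c - c * measure lborel K / (2*pi) + \<epsilon> \<in> L" by (simp add: L_def)
    then have "Inf L \<le> c - c * measure lborel K / (2*pi) + \<epsilon>" using L(2) by (rule cInf_lower)
    then have "c * measure lborel K / (2*pi) \<le> 2 * \<epsilon>" using c(2) by simp
    then have "c * measure lborel K \<le> \<delta> * s / 2" by (simp add: \<epsilon>_def field_simps)
    moreover have "s * measure lborel K \<le> c * measure lborel K" using sc by (intro mult_right_mono) auto
    ultimately have "s * measure lborel K \<le> s * (\<delta> / 2)" by (simp add: mult.commute)
    then have mK: "measure lborel K \<le> \<delta> / 2" using s(1) by (simp only: mult_le_cancel_left_pos)
    have sets: "K \<in> sets lborel" "?B - K \<in> sets lborel" using K(1) B by auto
    have "emeasure lborel ?B = emeasure lborel (K \<union> (?B - K))" using K(2) by (intro arg_cong[of _ _ "emeasure lborel"]) blast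
    also have "\<dots> = emeasure lborel K + emeasure lborel (?B - K)"
      by (rule plus_emeasure[symmetric]) (use sets in auto)
    also have "\<dots> = ennreal (measure lborel K) + emeasure lebesgue (?B - K)"
      using emeasure_eq_ennreal_measure[of lborel K] emeasure_compact_finite[OF cK] sets by simp
    also have "\<dots> \<le> ennreal (\<delta> / 2) + ennreal (\<delta> / 4)"
      using mK K(3) by (intro add_mono ennreal_leI) auto
    also have "\<dots> < ennreal \<delta>" using \<delta> by (simp add: ennreal_plus[symmetric] ennreal_less_iff del: ennreal_plus)
    finally show ?thesis .
  qed
  then show "\<forall>\<^sub>F r in at_right 0. emeasure lborel {t \<in> {0..2*pi}. u (w + (of_real r * cis t) *s X) < ereal (ln r)} < ennreal \<delta>"
    using r1(1) unfolding eventually_at_right_field by blast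
qed

section \<open>Rotation invariance of Lebesgue measure\<close>

lemma nn_integral_lborel_translation:
  fixes f :: "'a::euclidean_space \<Rightarrow> ennreal"
  assumes [measurable]: "f \<in> borel_measurable borel"
  shows "(\<integral>\<^sup>+x. f (c + x) \<partial>lborel) = (\<integral>\<^sup>+x. f x \<partial>lborel)"
  by (subst (2) lborel_distr_plus[of c, symmetric]) (simp add: nn_integral_distr)

lemma nn_integral_lborel_reflection:
  fixes f :: "'a::euclidean_space \<Rightarrow> ennreal"
  assumes [measurable]: "f \<in> borel_measurable borel"
  shows "(\<integral>\<^sup>+x. f (c - x) \<partial>lborel) = (\<integral>\<^sup>+x. f x \<partial>lborel)"
  by (subst (2) lborel_affine[of "-1" c]) (simp_all add: nn_integral_distr nn_integral_density density_1)

text \<open>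
  Writing \<open>\<mu> E = \<lambda> (T -` E)\<close>, Tonelli's theorem for \<open>1\<^sub>E (T x) 1\<^sub>F (y + T x)\<close> gives
  \<open>\<mu> E \<cdot> \<lambda> F = \<mu> F \<cdot> \<lambda> E\<close>; a ball \<open>F\<close> then identifies \<open>\<mu>\<close> with \<open>\<lambda>\<close>.
\<close>

lemma emeasure_lborel_orthogonal_vimage:
  fixes T :: "'a::euclidean_space \<Rightarrow> 'a"
  assumes T: "orthogonal_transformation T" and E[measurable]: "E \<in> sets borel"
  shows "emeasure lborel (T -` E) = emeasure lborel E"
proof -
  have lin: "linear T" and norm: "norm (T x) = norm x" for x
    using T by (auto simp: orthogonal_transformation)
  have "continuous_on UNIV T" using lin by (simp add: linear_continuous_on linear_conv_bounded_linear)
  then have [measurable]: "T \<in> borel_measurable borel" by (rule borel_measurable_continuous_onI)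
  obtain S where S: "\<And>y. T (S y) = y" using orthogonal_transformation_surj[OF T] by (metis surjD)
  define F where "F = ball (0::'a) 1"
  have [measurable]: "F \<in> sets borel" by (simp add: F_def)
  have meas: "emeasure lborel (T -` A) = (\<integral>\<^sup>+x. indicator A (T x) \<partial>lborel)" if [measurable]: "A \<in> sets borel" for A
  proof -
    have "T -` A \<in> sets lborel" using measurable_sets[of T borel borel A] by simp
    then have "emeasure lborel (T -` A) = (\<integral>\<^sup>+x. indicator (T -` A) x \<partial>lborel)" by simp
    then show ?thesis by (simp add: indicator_vimage o_def)
  qed
  have "emeasure lborel (T -` E) * emeasure lborel F
      = (\<integral>\<^sup>+x. indicator E (T x) * (\<integral>\<^sup>+y. indicator F (T x + y) \<partial>lborel) \<partial>lborel)"
    by (subst nn_integral_lborel_translation) (simp_all add: meas nn_integral_multc)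
  also have "\<dots> = (\<integral>\<^sup>+x. (\<integral>\<^sup>+y. indicator E (T x) * indicator F (T x + y) \<partial>lborel) \<partial>lborel)"
    by (simp add: nn_integral_cmult)
  also have "\<dots> = (\<integral>\<^sup>+y. (\<integral>\<^sup>+x. indicator E (T x) * indicator F (T x + y) \<partial>lborel) \<partial>lborel)"
    by (rule lborel_pair.Fubini') measurable
  \<comment> \<open>Translating \<open>x\<close> by \<open>- S y\<close>, where
    \<open>T (S y) = y\<close>, moves the shift from \<open>F\<close> to \<open>E\<close>. After the
    second exchange of integrals it is removed by invariance under
    \<open>y \<mapsto> T x - y\<close>.\<close>
  also have "\<dots> = (\<integral>\<^sup>+y. (\<integral>\<^sup>+x. indicator E (T x - y) * indicator F (T x) \<partial>lborel) \<partial>lborel)"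
  proof (rule nn_integral_cong)
    fix y
    have "T (- S y + x) = T x - y" for x
      using linear_add[OF lin, of "- S y" x] linear_neg[OF lin, of "S y"] S by simp
    moreover have "(\<integral>\<^sup>+x. indicator E (T (- S y + x)) * indicator F (T (- S y + x) + y) \<partial>lborel)
       = (\<integral>\<^sup>+x. indicator E (T x) * indicator F (T x + y) \<partial>lborel)"
      by (rule nn_integral_lborel_translation[where f = "\<lambda>x. indicator E (T x) * indicator F (T x + y)"]) measurable
    ultimately show "(\<integral>\<^sup>+x. indicator E (T x) * indicator F (T x + y) \<partial>lborel)
       = (\<integral>\<^sup>+x. indicator E (T x - y) * indicator F (T x) \<partial>lborel)" by simp
  qed
  also have "\<dots> = (\<integral>\<^sup>+x. (\<integral>\<^sup>+y. indicator E (T x - y) * indicator F (T x) \<partial>lborel) \<partial>lborel)"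
    by (rule lborel_pair.Fubini') measurable
  also have "\<dots> = (\<integral>\<^sup>+x. (\<integral>\<^sup>+y. indicator E (T x - y) \<partial>lborel) * indicator F (T x) \<partial>lborel)"
    by (simp add: nn_integral_multc)
  also have "\<dots> = emeasure lborel E * emeasure lborel (T -` F)"
    by (subst nn_integral_lborel_reflection) (simp_all add: meas nn_integral_cmult)
  also have "T -` F = F" by (auto simp: F_def norm)
  finally have "emeasure lborel (T -` E) * emeasure lborel F = emeasure lborel E * emeasure lborel F" .
  moreover have "emeasure lborel F \<noteq> 0"
  proof
    assume "emeasure lborel F = 0"
    then have "F \<in> null_sets lborel" by (intro null_setsI) auto
    then have "negligible F" by (simp add: negligible_iff_null_sets null_sets_completionI)
    then show False using open_not_negligible[of F] by (simp add: F_def)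
  qed
  moreover have "emeasure lborel F \<noteq> \<infinity>"
    unfolding F_def using emeasure_lborel_ball_finite[of "0::'a" 1] by simp
  ultimately show ?thesis by (simp add: mult.commute[of _ "emeasure lborel F"] ennreal_mult_cancel_left)
qed

lemma orthogonal_transformation_cis: "orthogonal_transformation (\<lambda>X :: complex ^ 'n. cis t *s X)"
  unfolding orthogonal_transformation
  by (auto simp: norm_vector_scalar_mult intro!: linearI simp: vec_eq_iff scaleR_conv_of_real algebra_simps)

lemma nn_integral_circle_measure:
  fixes E :: "(complex ^ 'n) set"
  assumes "open E"
  shows "(\<integral>\<^sup>+X. emeasure lborel {t \<in> {0..2*pi}. cis t *s X \<in> E} \<partial>lborel) = ennreal (2*pi) * emeasure lborel E"
    and "(\<lambda>X. emeasure lborel {t \<in> {0..2*pi}. cis t *s X \<in> E}) \<in> borel_measurable borel"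
proof -
  let ?I = "{0..2*pi}"
  have "continuous_on UNIV (\<lambda>p :: real \<times> (complex ^ 'n). cis (fst p) *s snd p)"
    by (intro continuous_intros)
  then have [measurable]: "(\<lambda>p :: real \<times> (complex ^ 'n). cis (fst p) *s snd p) \<in> borel_measurable (borel \<Otimes>\<^sub>M borel)"
    unfolding borel_prod by (rule borel_measurable_continuous_onI)
  have [measurable]: "E \<in> sets borel" using assms by simp
  have m: "(\<lambda>p. indicator ?I (fst p) * indicator E (cis (fst p) *s snd p) :: ennreal) \<in> borel_measurable (lborel \<Otimes>\<^sub>M lborel)"
    by measurable
  have *: "emeasure lborel {t \<in> ?I. cis t *s X \<in> E} = (\<integral>\<^sup>+t. indicator ?I t * indicator E (cis t *s X) \<partial>lborel)" for X
  proof -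
    have "continuous_on UNIV (\<lambda>t. cis t *s X)" by (intro continuous_intros)
    then have "open ((\<lambda>t. cis t *s X) -` E)" using assms by (intro open_vimage)
    then have "?I \<inter> (\<lambda>t. cis t *s X) -` E \<in> sets lborel" by auto
    moreover have "{t \<in> ?I. cis t *s X \<in> E} = ?I \<inter> (\<lambda>t. cis t *s X) -` E" by auto
    ultimately have "emeasure lborel {t \<in> ?I. cis t *s X \<in> E} = (\<integral>\<^sup>+t. indicator {t \<in> ?I. cis t *s X \<in> E} t \<partial>lborel)" by simp
    also have "\<dots> = (\<integral>\<^sup>+t. indicator ?I t * indicator E (cis t *s X) \<partial>lborel)"
      by (intro nn_integral_cong) (auto simp: indicator_def)
    finally show ?thesis .
  qed
  have "(\<lambda>X. \<integral>\<^sup>+t. indicator ?I t * indicator E (cis t *s X) \<partial>lborel) \<in> borel_measurable lborel"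
    using m by (intro lborel.borel_measurable_nn_integral) (simp add: split_beta', subst measurable_pair_swap_iff, simp add: split_beta')
  then show "(\<lambda>X. emeasure lborel {t \<in> ?I. cis t *s X \<in> E}) \<in> borel_measurable borel" unfolding * by simp
  have "(\<integral>\<^sup>+X. emeasure lborel {t \<in> ?I. cis t *s X \<in> E} \<partial>lborel)
     = (\<integral>\<^sup>+t. (\<integral>\<^sup>+X. indicator ?I t * indicator E (cis t *s X) \<partial>lborel) \<partial>lborel)"
    unfolding * by (rule lborel_pair.Fubini') (use m in \<open>simp add: split_beta'\<close>)
  also have "\<dots> = (\<integral>\<^sup>+t. indicator ?I t * emeasure lborel E \<partial>lborel)"
  proof (rule nn_integral_cong)
    fix t
    have [measurable]: "(\<lambda>X :: complex ^ 'n. cis t *s X) \<in> borel_measurable borel"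
      by (intro borel_measurable_continuous_onI continuous_intros)
    have "(\<lambda>X. cis t *s X) -` E \<in> sets lborel"
      using measurable_sets[of "\<lambda>X. cis t *s X" borel borel E] by simp
    then have "(\<integral>\<^sup>+X. indicator E (cis t *s X) \<partial>lborel) = emeasure lborel ((\<lambda>X. cis t *s X) -` E)"
      by (simp add: indicator_vimage o_def flip: nn_integral_indicator)
    also have "\<dots> = emeasure lborel E"
      by (rule emeasure_lborel_orthogonal_vimage[OF orthogonal_transformation_cis]) simp
    finally show "(\<integral>\<^sup>+X. indicator ?I t * indicator E (cis t *s X) \<partial>lborel) = indicator ?I t * emeasure lborel E"
      by (simp add: nn_integral_cmult)
  qed
  also have "\<dots> = ennreal (2*pi) * emeasure lborel E"
    by (simp add: nn_integral_multc)
  finally show "(\<integral>\<^sup>+X. emeasure lborel {t \<in> ?I. cis t *s X \<in> E} \<partial>lborel) = ennreal (2*pi) * emeasure lborel E" .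
qed


section \<open>Sublevel sets of the Azukawa function\<close>

text \<open>The set \<open>{A < s}\<close>: the strict \<open>c < s\<close> expresses that an upper
  limit is below \<open>s\<close> exactly when some smaller constant is an eventual bound.\<close>

definition azukawa_sublevel :: "(complex ^ 'n) set \<Rightarrow> complex ^ 'n \<Rightarrow> real \<Rightarrow> (complex ^ 'n) set" where
  "azukawa_sublevel \<Omega> w s = {X. \<exists>c<s. \<exists>r>0. disc_bound \<Omega> (green \<Omega> w) w X r c}"

lemma azukawa_sublevel_mono: "s \<le> s' \<Longrightarrow> azukawa_sublevel \<Omega> w s \<subseteq> azukawa_sublevel \<Omega> w s'"
  unfolding azukawa_sublevel_def by force

lemma scaleR_eq_vector_scalar_mult: "a *\<^sub>R X = of_real a *s (X :: complex ^ 'n)"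
  by (simp add: vec_eq_iff) (simp add: scaleR_conv_of_real)

lemma eventually_line_in:
  fixes w :: "complex ^ 'n"
  assumes "open \<Omega>" "w \<in> \<Omega>"
  shows "\<forall>\<^sub>F \<zeta> in at 0. w + \<zeta> *s X \<in> \<Omega>"
proof -
  have "continuous_on UNIV (\<lambda>\<zeta>. w + \<zeta> *s X)" by (intro continuous_intros)
  then have "((\<lambda>\<zeta>. w + \<zeta> *s X) \<longlongrightarrow> w + 0 *s X) (at 0)"
    using continuous_on_eq_continuous_at[OF open_UNIV] isCont_def by blast
  then show ?thesis using assms by (intro topological_tendstoD) auto
qed

lemma azukawa_indicatrix_eq_sublevel:
  fixes w :: "complex ^ 'n"
  assumes "open \<Omega>" "w \<in> \<Omega>"
  shows "azukawa_indicatrix \<Omega> w = azukawa_sublevel \<Omega> w 0"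
proof (rule set_eqI)
  fix X
  let ?f = "\<lambda>\<zeta>::complex. green \<Omega> w (w + \<zeta> *s X) - elog (norm \<zeta>)"
  have "Limsup (at 0) ?f < 0 \<longleftrightarrow> (\<exists>c<0. \<exists>r>0. disc_bound \<Omega> (green \<Omega> w) w X r c)"
  proof
    assume "Limsup (at 0) ?f < 0"
    then obtain c where c: "Limsup (at 0) ?f < ereal c" "ereal c < 0" using ereal_dense2 by blast
    have "\<forall>\<^sub>F \<zeta> in at 0. ?f \<zeta> < ereal c \<and> w + \<zeta> *s X \<in> \<Omega>"
      using Limsup_lessD[OF c(1)] eventually_line_in[OF assms, of X] by (rule eventually_conj)
    then obtain d where d: "d > 0" "\<And>\<zeta>. \<zeta> \<noteq> 0 \<Longrightarrow> norm \<zeta> < d \<Longrightarrow> ?f \<zeta> < ereal c \<and> w + \<zeta> *s X \<in> \<Omega>"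
      unfolding eventually_at by auto
    have "disc_bound \<Omega> (green \<Omega> w) w X (d/2) c"
      unfolding disc_bound_def
    proof (intro allI impI conjI)
      fix \<zeta> :: complex assume \<zeta>: "norm \<zeta> \<le> d/2"
      show "w + \<zeta> *s X \<in> \<Omega>" using d(2)[of \<zeta>] \<zeta> d(1) assms(2) by (cases "\<zeta> = 0") auto
      assume "\<zeta> \<noteq> 0"
      then have "?f \<zeta> < ereal c" using d(2)[of \<zeta>] \<zeta> d(1) by auto
      then show "green \<Omega> w (w + \<zeta> *s X) \<le> ereal (ln (norm \<zeta>) + c)"
        using \<open>\<zeta> \<noteq> 0\<close> by (cases "green \<Omega> w (w + \<zeta> *s X)") (auto simp: elog_def)
    qed
    then show "\<exists>c<0. \<exists>r>0. disc_bound \<Omega> (green \<Omega> w) w X r c"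
      using c(2) d(1) by (intro exI[of _ c] conjI exI[of _ "d/2"]) (auto simp: zero_ereal_def)
  next
    assume "\<exists>c<0. \<exists>r>0. disc_bound \<Omega> (green \<Omega> w) w X r c"
    then obtain c r where c: "c < 0" "0 < r" "disc_bound \<Omega> (green \<Omega> w) w X r c" by blast
    have "\<forall>\<^sub>F \<zeta> in at 0. ?f \<zeta> \<le> ereal c"
      unfolding eventually_at
    proof (intro exI[of _ r] conjI ballI impI)
      fix \<zeta> :: complex assume \<zeta>: "\<zeta> \<noteq> 0 \<and> dist \<zeta> 0 < r"
      then have "green \<Omega> w (w + \<zeta> *s X) \<le> ereal (ln (norm \<zeta>) + c)" using c(3) by (simp add: disc_bound_def)
      then show "?f \<zeta> \<le> ereal c"
        using \<zeta> by (cases "green \<Omega> w (w + \<zeta> *s X)") (auto simp: elog_def)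
    qed (rule c(2))
    then have "Limsup (at 0) ?f \<le> ereal c" by (rule Limsup_bounded)
    also have "\<dots> < 0" using c(1) by simp
    finally show "Limsup (at 0) ?f < 0" .
  qed
  then show "X \<in> azukawa_indicatrix \<Omega> w \<longleftrightarrow> X \<in> azukawa_sublevel \<Omega> w 0"
    by (simp add: azukawa_indicatrix_def azukawa_sublevel_def)
qed

text \<open>Logarithmic homogeneity \<open>A(aX) = A(X) + ln a\<close>, from the substitution of
  \<open>a * \<zeta>\<close> for \<open>\<zeta>\<close>.\<close>

lemma disc_bound_scale:
  assumes a: "0 < a"
  shows "disc_bound \<Omega> u w (of_real a *s X) r c \<longleftrightarrow> disc_bound \<Omega> u w X (a * r) (c - ln a)"
proof -
  have 1: "norm \<zeta> \<le> r \<longleftrightarrow> norm (of_real a * \<zeta>) \<le> a * r" for \<zeta> :: complex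
    using a by (simp add: norm_mult)
  have 2: "ln (norm \<zeta>) + c = ln (norm (of_real a * \<zeta>)) + (c - ln a)" if "\<zeta> \<noteq> 0" for \<zeta> :: complex
    using a that by (simp add: norm_mult ln_mult)
  have 3: "w + \<zeta> *s (of_real a *s X) = w + (of_real a * \<zeta>) *s X" for \<zeta>
    by (simp add: vector_smult_assoc mult.commute)
  define P where "P \<zeta> \<longleftrightarrow> norm \<zeta> \<le> a * r \<longrightarrow> w + \<zeta> *s X \<in> \<Omega> \<and>
     (\<zeta> \<noteq> 0 \<longrightarrow> u (w + \<zeta> *s X) \<le> ereal (ln (norm \<zeta>) + (c - ln a)))" for \<zeta>
  have "(norm \<zeta> \<le> r \<longrightarrow> w + \<zeta> *s (of_real a *s X) \<in> \<Omega> \<and>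
     (\<zeta> \<noteq> 0 \<longrightarrow> u (w + \<zeta> *s (of_real a *s X)) \<le> ereal (ln (norm \<zeta>) + c))) \<longleftrightarrow> P (of_real a * \<zeta>)" for \<zeta>
    unfolding P_def 3 1[of \<zeta>] using 2[of \<zeta>] a by (cases "\<zeta> = 0") (simp_all only: mult_zero_right simp_thms mult_eq_0_iff of_real_eq_0_iff less_irrefl, auto)
  then have "disc_bound \<Omega> u w (of_real a *s X) r c \<longleftrightarrow> (\<forall>\<zeta>. P (of_real a * \<zeta>))"
    unfolding disc_bound_def by simp
  also have "\<dots> \<longleftrightarrow> (\<forall>\<zeta>. P \<zeta>)"
  proof (intro iffI allI)
    fix \<zeta> assume "\<forall>\<zeta>. P (of_real a * \<zeta>)"
    then have "P (of_real a * (\<zeta> / of_real a))" by blast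
    then show "P \<zeta>" using a by simp
  qed blast
  finally show ?thesis by (simp add: disc_bound_def P_def)
qed

lemma azukawa_sublevel_scale: "exp s *\<^sub>R X \<in> azukawa_sublevel \<Omega> w s \<longleftrightarrow> X \<in> azukawa_sublevel \<Omega> w 0"
proof
  assume "exp s *\<^sub>R X \<in> azukawa_sublevel \<Omega> w s"
  then obtain c r where "c < s" "0 < r" "disc_bound \<Omega> (green \<Omega> w) w X (exp s * r) (c - s)"
    by (auto simp: azukawa_sublevel_def scaleR_eq_vector_scalar_mult disc_bound_scale)
  then show "X \<in> azukawa_sublevel \<Omega> w 0"
    unfolding azukawa_sublevel_def by (intro CollectI exI[of _ "c - s"] conjI exI[of _ "exp s * r"]) auto
next
  assume "X \<in> azukawa_sublevel \<Omega> w 0"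
  then obtain c r where "c < 0" "0 < r" "disc_bound \<Omega> (green \<Omega> w) w X r c"
    by (auto simp: azukawa_sublevel_def)
  then show "exp s *\<^sub>R X \<in> azukawa_sublevel \<Omega> w s"
    unfolding azukawa_sublevel_def
    by (intro CollectI exI[of _ "c + s"] conjI exI[of _ "r / exp s"])
      (auto simp: scaleR_eq_vector_scalar_mult disc_bound_scale)
qed

lemma green_pole:
  fixes w :: "complex ^ 'n"
  assumes "open \<Omega>" "w \<in> \<Omega>"
  obtains C where "\<forall>\<^sub>F z in nhds w. green \<Omega> w z \<le> elog (norm (z - w)) + ereal C"
proof -
  obtain r where r: "0 < r" "cball w r \<subseteq> \<Omega>" using assms open_contains_cball by blast
  have "\<forall>\<^sub>F z in nhds w. z \<in> ball w r" using r(1) by (intro eventually_nhds_in_open) auto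
  then have "\<forall>\<^sub>F z in nhds w. green \<Omega> w z \<le> elog (norm (z - w)) + ereal (- ln r)"
    by eventually_elim (rule green_le[OF r], simp)
  then show ?thesis using that by blast
qed

text \<open>By the maximum principle a bound on one circle yields the bound on the whole punctured
  disc. On the compact circle of radius \<open>r\<close> the inequality with \<open>c' > c\<close>
  is strict, so upper semicontinuity of the Green function carries it over to all nearby directions
  \<open>Y\<close> with the same radius. The passage from \<open>c\<close> to \<open>c'\<close>
  still leaves \<open>c' < s\<close>.\<close>

lemma open_azukawa_sublevel:
  fixes w :: "complex ^ 'n"
  assumes "open \<Omega>" "w \<in> \<Omega>"
  shows "open (azukawa_sublevel \<Omega> w s)"
  unfolding open_subopen[of "azukawa_sublevel \<Omega> w s"]
proof
  fix X assume "X \<in> azukawa_sublevel \<Omega> w s"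
  then obtain c r where c: "c < s" "0 < r" and db: "disc_bound \<Omega> (green \<Omega> w) w X r c"
    by (auto simp: azukawa_sublevel_def)
  note psh = psh_on_green[OF assms]
  obtain c' where c': "c < c'" "c' < s" using c(1) dense by blast
  obtain C where pole: "\<forall>\<^sub>F z in nhds w. green \<Omega> w z \<le> elog (norm (z - w)) + ereal C"
    using green_pole[OF assms] .
  let ?f = "\<lambda>p. w + snd p *s fst p :: complex ^ 'n"
  have "open (?f -` \<Omega>)" by (intro open_vimage assms(1) continuous_intros)
  moreover have "{X} \<times> cball 0 r \<subseteq> ?f -` \<Omega>" using db by (auto simp: disc_bound_def)
  ultimately have "\<exists>Y. X \<in> Y \<and> open Y \<and> Y \<times> cball 0 r \<subseteq> ?f -` \<Omega>"
    by (intro Elementary_Topology.tube_lemma compact_cball)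
  then obtain Y1 where Y1: "X \<in> Y1" "open Y1" "Y1 \<times> cball 0 r \<subseteq> ?f -` \<Omega>" by blast
  have "open {z \<in> \<Omega>. green \<Omega> w z < ereal (ln r + c')}"
    using psh assms(1) by (simp add: psh_on_def usc_on_open_iff)
  then have "open (?f -` {z \<in> \<Omega>. green \<Omega> w z < ereal (ln r + c')})"
    by (intro open_vimage continuous_intros)
  moreover have "{X} \<times> sphere 0 r \<subseteq> ?f -` {z \<in> \<Omega>. green \<Omega> w z < ereal (ln r + c')}"
  proof clarsimp
    fix \<zeta> :: complex assume \<zeta>: "r = norm \<zeta>"
    have "\<zeta> \<noteq> 0" using c(2) \<zeta> by auto
    then have "w + \<zeta> *s X \<in> \<Omega>" "green \<Omega> w (w + \<zeta> *s X) \<le> ereal (ln r + c)"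
      using db \<zeta> by (auto simp: disc_bound_def)
    moreover have "ereal (ln r + c) < ereal (ln r + c')" using c'(1) by simp
    ultimately show "w + \<zeta> *s X \<in> \<Omega> \<and> green \<Omega> w (w + \<zeta> *s X) < ereal (ln (norm \<zeta>) + c')"
      unfolding \<zeta> by (metis le_less_trans)
  qed
  ultimately have "\<exists>Y. X \<in> Y \<and> open Y \<and> Y \<times> sphere 0 r \<subseteq> ?f -` {z \<in> \<Omega>. green \<Omega> w z < ereal (ln r + c')}"
    by (intro Elementary_Topology.tube_lemma compact_sphere)
  then obtain Y2 where Y2: "X \<in> Y2" "open Y2" "Y2 \<times> sphere 0 r \<subseteq> ?f -` {z \<in> \<Omega>. green \<Omega> w z < ereal (ln r + c')}" by blast
  have "Y \<in> azukawa_sublevel \<Omega> w s" if Y: "Y \<in> Y1" "Y \<in> Y2" for Y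
  proof -
    have on: "w + \<zeta> *s Y \<in> \<Omega>" if "norm \<zeta> \<le> r" for \<zeta>
      using subsetD[OF Y1(3), of "(Y, \<zeta>)"] Y(1) that by simp
    have less: "green \<Omega> w (w + \<zeta> *s Y) < ereal (ln r + c')" if "norm \<zeta> = r" for \<zeta>
      using subsetD[OF Y2(3), of "(Y, \<zeta>)"] Y(2) that by simp
    have "disc_bound \<Omega> (green \<Omega> w) w (of_real r *s Y) 1 (ln r + c')"
      unfolding disc_bound_def
    proof (intro allI impI conjI)
      fix \<zeta> :: complex assume \<zeta>: "norm \<zeta> \<le> 1"
      have on': "w + \<xi> *s (of_real r *s Y) \<in> \<Omega>" if "norm \<xi> \<le> 1" for \<xi>
        using on[of "\<xi> * of_real r"] that c(2) by (simp add: vector_smult_assoc norm_mult mult_left_le_one_le)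
      then show "w + \<zeta> *s (of_real r *s Y) \<in> \<Omega>" using \<zeta> by blast
      assume "\<zeta> \<noteq> 0"
      have "green \<Omega> w (w + \<zeta> *s (of_real r *s Y)) \<le> ereal (ln (norm \<zeta>) + Re (of_real (ln r + c')))"
      proof (rule psh_on_line_log_pole_le[OF psh pole on' _ _ \<open>\<zeta> \<noteq> 0\<close> \<zeta>])
        show "green \<Omega> w (w + \<xi> *s (of_real r *s Y)) \<le> ereal (Re (of_real (ln r + c')))" if "norm \<xi> = 1" for \<xi>
          using less[of "\<xi> * of_real r"] that c(2) by (simp add: vector_smult_assoc norm_mult less_imp_le)
      qed auto
      then show "green \<Omega> w (w + \<zeta> *s (of_real r *s Y)) \<le> ereal (ln (norm \<zeta>) + (ln r + c'))" by simp
    qed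
    then have "disc_bound \<Omega> (green \<Omega> w) w Y r c'" using c(2) by (simp add: disc_bound_scale)
    then show ?thesis unfolding azukawa_sublevel_def using c'(2) c(2) by blast
  qed
  then show "\<exists>T. open T \<and> X \<in> T \<and> T \<subseteq> azukawa_sublevel \<Omega> w s"
    using Y1(1,2) Y2(1,2) by (intro exI[of _ "Y1 \<inter> Y2"]) auto
qed

lemma disc_bound_green_exists:
  fixes w :: "complex ^ 'n"
  assumes "open \<Omega>" "w \<in> \<Omega>"
  obtains c r where "0 < r" "disc_bound \<Omega> (green \<Omega> w) w X r c"
proof -
  obtain \<rho> where \<rho>: "0 < \<rho>" "cball w \<rho> \<subseteq> \<Omega>" using assms open_contains_cball by blast
  \<comment> \<open>Adding 1 in the denominator covers \<open>X = 0\<close>; in that case the Green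
    function is \<open>-\<infinity>\<close> at the pole and the constant 0 below is
    arbitrary.\<close>
  define r where "r = \<rho> / (norm X + 1)"
  have pos: "0 < norm X + 1" by (simp add: add_nonneg_pos)
  have r: "0 < r" using \<rho>(1) pos by (simp add: r_def)
  have "disc_bound \<Omega> (green \<Omega> w) w X r (if X = 0 then 0 else ln (norm X) - ln \<rho>)"
    unfolding disc_bound_def
  proof (intro allI impI)
    fix \<zeta> :: complex assume \<zeta>: "norm \<zeta> \<le> r"
    have "norm \<zeta> * norm X \<le> r * (norm X + 1)" using \<zeta> r by (intro mult_mono) auto
    also have "\<dots> = \<rho>" using pos by (simp add: r_def)
    finally have zin: "w + \<zeta> *s X \<in> cball w \<rho>" by (simp add: dist_norm norm_vector_scalar_mult)
    then show "w + \<zeta> *s X \<in> \<Omega> \<and> (\<zeta> \<noteq> 0 \<longrightarrow>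
        green \<Omega> w (w + \<zeta> *s X) \<le> ereal (ln (norm \<zeta>) + (if X = 0 then 0 else ln (norm X) - ln \<rho>)))"
      using \<rho>(2) green_le[OF \<rho> zin]
      by (auto simp: elog_def norm_vector_scalar_mult ln_mult algebra_simps split: if_splits)
  qed
  then show ?thesis using that r by blast
qed

lemma azukawa_sublevel_subset_ball:
  fixes w :: "complex ^ 'n"
  assumes R: "0 < R" "\<Omega> \<subseteq> ball w R"
  shows "azukawa_sublevel \<Omega> w s \<subseteq> ball 0 (exp s * R)"
proof
  fix X assume "X \<in> azukawa_sublevel \<Omega> w s"
  then obtain c r where c: "c < s" "0 < r" "disc_bound \<Omega> (green \<Omega> w) w X r c"
    by (auto simp: azukawa_sublevel_def)
  show "X \<in> ball 0 (exp s * R)"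
  proof (cases "X = 0")
    case False
    have "w + of_real r *s X \<in> \<Omega>" "green \<Omega> w (w + of_real r *s X) \<le> ereal (ln r + c)"
      using c(2,3) by (auto simp: disc_bound_def dest: spec[of _ "of_real r"])
    with le_green[OF R this(1)] have "elog (r * norm X) + ereal (- ln R) \<le> ereal (ln r + c)"
      using c(2) by (simp add: norm_vector_scalar_mult)
    then have "ln (norm X) \<le> c + ln R" using False c(2) by (simp add: elog_def ln_mult)
    then have "ln (norm X) < ln (exp s * R)" using c(1) R(1) by (simp add: ln_mult)
    then show ?thesis using False R(1) by simp
  qed (use R in simp)
qed

lemma emeasure_lborel_affine:
  fixes A :: "'a::euclidean_space set"
  assumes "0 < a" "A \<in> sets borel"
  shows "emeasure lborel A = ennreal (a ^ DIM('a)) * emeasure lborel ((\<lambda>x. v + a *\<^sub>R x) -` A)"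
proof -
  have "emeasure lborel A = emeasure (density (distr lborel borel (\<lambda>x. v + a *\<^sub>R x)) (\<lambda>_. \<bar>a\<bar> ^ DIM('a))) A"
    using lborel_affine[of a v] assms(1) by simp
  also have "\<dots> = ennreal (a ^ DIM('a)) * emeasure lborel ((\<lambda>x. v + a *\<^sub>R x) -` A)"
    using assms by (simp add: emeasure_density nn_integral_cmult_indicator emeasure_distr)
  finally show ?thesis .
qed

text \<open>The exceptional set is \<open>{A = 0}\<close>. By homogeneity the measure of
  \<open>{A < s}\<close> is \<open>exp s\<close> to the power of the real dimension times that of
  \<open>{A < 0}\<close>; as these measures are finite, the difference vanishes when
  \<open>s\<close> decreases to 0.\<close>

lemma AE_azukawa_sublevel:
  fixes w :: "complex ^ 'n"
  assumes \<Omega>: "open \<Omega>" "w \<in> \<Omega>" and R: "0 < R" "\<Omega> \<subseteq> ball w R"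
  shows "AE X in lborel. (\<forall>s>0. X \<in> azukawa_sublevel \<Omega> w s) \<longrightarrow> X \<in> azukawa_sublevel \<Omega> w 0"
proof -
  let ?J = "azukawa_sublevel \<Omega> w"
  let ?D = "DIM(complex ^ 'n)"
  have meas: "?J s \<in> sets lborel" for s using open_azukawa_sublevel[OF \<Omega>] by simp
  define N where "N = (\<Inter>k::nat. ?J (1 / real (Suc k))) - ?J 0"
  have Nm: "N \<in> sets lborel" unfolding N_def using meas by (intro sets.Diff sets.countable_INT) auto
  have fin: "emeasure lborel (?J s) < \<infinity>" for s
    using azukawa_sublevel_subset_ball[OF R, of s]
    by (intro emeasure_bounded_finite) (use bounded_subset bounded_ball in blast)
  define j where "j = measure lborel (?J 0)"
  have j: "emeasure lborel (?J 0) = ennreal j" using fin[of 0] by (simp add: j_def emeasure_eq_ennreal_measure)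
  have Js: "emeasure lborel (?J s) = ennreal (exp s ^ ?D * j)" for s
  proof -
    have "(\<lambda>X. 0 + exp s *\<^sub>R X) -` ?J s = ?J 0" by (auto simp: azukawa_sublevel_scale)
    then show ?thesis
      using emeasure_lborel_affine[of "exp s" "?J s" 0] meas[of s] j by (simp add: ennreal_mult'' j_def)
  qed
  have N_le: "emeasure lborel N \<le> ennreal (exp s ^ ?D * j - j)" if s: "0 < s" for s
  proof -
    obtain k where "1 / real (Suc k) < s" using s nat_approx_posE by blast
    then have "N \<subseteq> ?J s - ?J 0" using azukawa_sublevel_mono[of "1 / real (Suc k)" s \<Omega> w] by (auto simp: N_def)
    then have "emeasure lborel N \<le> emeasure lborel (?J s - ?J 0)" using meas by (intro emeasure_mono) auto
    also have "\<dots> = emeasure lborel (?J s) - emeasure lborel (?J 0)"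
      using meas fin[of 0] azukawa_sublevel_mono[of 0 s \<Omega> w] s by (intro emeasure_Diff) auto
    also have "\<dots> = ennreal (exp s ^ ?D * j - j)" unfolding Js[of s] j by (rule ennreal_minus) (simp add: j_def)
    finally show ?thesis .
  qed
  have "((\<lambda>s. ennreal (exp s ^ ?D * j - j)) \<longlongrightarrow> ennreal (exp 0 ^ ?D * j - j)) (at_right 0)"
    by (intro tendsto_intros)
  moreover have "\<forall>\<^sub>F s in at_right 0. emeasure lborel N \<le> ennreal (exp s ^ ?D * j - j)"
    using N_le by (auto simp: eventually_at_right_field intro: exI[of _ 1])
  ultimately have "emeasure lborel N \<le> ennreal (exp 0 ^ ?D * j - j)" by (intro tendsto_lowerbound) auto
  then have "N \<in> null_sets lborel" using Nm by (intro null_setsI) auto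
  then have "AE X in lborel. X \<notin> N" by (rule AE_not_in)
  then show ?thesis
  proof eventually_elim
    case (elim X)
    show ?case
    proof
      assume "\<forall>s>0. X \<in> ?J s"
      then have "X \<in> (\<Inter>k::nat. ?J (1 / real (Suc k)))" by simp
      then show "X \<in> ?J 0" using elim by (simp add: N_def)
    qed
  qed
qed

section \<open>Dominated convergence over the directions\<close>

theorem theorem1:
  fixes \<Omega> :: "(complex ^ 'n) set" and w :: "complex ^ 'n"
  assumes "bounded_hyperconvex_domain \<Omega>" and "w \<in> \<Omega>"
  shows "((\<lambda>t::real. ennreal (exp (- 2 * real CARD('n) * t)) *
              emeasure lebesgue {z \<in> \<Omega>. green \<Omega> w z < ereal t})
          \<longlongrightarrow> emeasure lebesgue (azukawa_indicatrix \<Omega> w)) at_bot"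
proof -
  have \<Omega>: "open \<Omega>" "w \<in> \<Omega>" and "bounded \<Omega>" using assms by (auto simp: bounded_hyperconvex_domain_def)
  obtain R where R: "0 < R" "\<Omega> \<subseteq> ball w R"
  proof -
    obtain e where "\<Omega> \<subseteq> cball w e" using \<open>bounded \<Omega>\<close> by (auto simp: bounded_any_center[where a=w] subset_iff)
    moreover have "cball w e \<subseteq> ball w (max e 0 + 1)" by (rule subsetI) simp
    ultimately have "\<Omega> \<subseteq> ball w (max e 0 + 1)" by (rule order_trans)
    then show ?thesis using that[of "max e 0 + 1"] by simp
  qed
  note psh = psh_on_green[OF \<Omega>]
  obtain C where pole: "\<forall>\<^sub>F z in nhds w. green \<Omega> w z \<le> elog (norm (z - w)) + ereal C"
    using green_pole[OF \<Omega>] .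
  let ?I = "{0..2*pi}" and ?J = "azukawa_sublevel \<Omega> w"
  define S where "S t = {z \<in> \<Omega>. green \<Omega> w z < ereal t}" for t
  \<comment> \<open>\<open>E t\<close> is the rescaled sublevel set \<open>{g_t < 0}\<close>, and
    \<open>M t X\<close> is \<open>2*pi\<close> times the proportion of angles for which the rotated
    direction lies in it.\<close>
  define E where "E t = (\<lambda>X. w + exp t *\<^sub>R X) -` S t" for t
  define M where "M t X = emeasure lborel {\<theta> \<in> ?I. cis \<theta> *s X \<in> E t}" for t X
  have openS: "open (S t)" for t using psh \<Omega>(1) by (simp add: psh_on_def usc_on_open_iff S_def)
  have openE: "open (E t)" for t unfolding E_def by (intro open_vimage openS continuous_intros)
  have scale: "ennreal (exp (- 2 * real CARD('n) * t)) * emeasure lebesgue (S t) = emeasure lborel (E t)" for t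
  proof -
    have "emeasure lebesgue (S t) = ennreal (exp t ^ (2 * CARD('n))) * emeasure lborel (E t)"
      using emeasure_lborel_affine[of "exp t" "S t" w] openS[of t] by (simp add: E_def mult.commute)
    moreover have "ennreal (exp (- 2 * real CARD('n) * t)) * ennreal (exp t ^ (2 * CARD('n))) = 1"
      by (simp add: ennreal_mult[symmetric] exp_of_nat_mult[symmetric] exp_add[symmetric])
    ultimately show ?thesis by (simp add: mult.assoc[symmetric])
  qed
  have mem: "cis \<theta> *s X \<in> E t \<longleftrightarrow> w + (of_real (exp t) * cis \<theta>) *s X \<in> S t" for \<theta> X t
    by (simp add: E_def scaleR_eq_vector_scalar_mult vector_smult_assoc)
  \<comment> \<open>If a rotation of \<open>X\<close> lies in \<open>E t\<close>, then
    \<open>le_green\<close> gives \<open>t + ln (norm X) - ln R < t\<close>, so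
    \<open>norm X < R\<close> independently of \<open>t\<close>.\<close>
  have M_le: "M t X \<le> ennreal (2*pi) * indicator (ball 0 R) X" for t X
  proof (cases "X \<in> ball 0 R")
    case True
    have "M t X \<le> emeasure lborel ?I" unfolding M_def by (intro emeasure_mono) auto
    then show ?thesis using True by simp
  next
    case False
    have "cis \<theta> *s X \<notin> E t" for \<theta>
    proof
      assume "cis \<theta> *s X \<in> E t"
      then have z: "w + (of_real (exp t) * cis \<theta>) *s X \<in> \<Omega>"
          "green \<Omega> w (w + (of_real (exp t) * cis \<theta>) *s X) < ereal t" by (auto simp: mem S_def)
      have "elog (exp t * norm X) + ereal (- ln R) < ereal t"
        using le_less_trans[OF le_green[OF R z(1)] z(2)] by (simp add: norm_vector_scalar_mult norm_mult)
      moreover have "X \<noteq> 0" using False R(1) by auto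
      ultimately have "ln (norm X) < ln R" by (simp add: elog_def ln_mult)
      then show False using False R(1) \<open>X \<noteq> 0\<close> by simp
    qed
    then show ?thesis by (simp add: M_def)
  qed
  have lim_exp: "filterlim exp (at_right (0::real)) at_bot"
    using exp_at_bot by (simp add: filterlim_at)
  have M_lim: "((\<lambda>t. M t X) \<longlongrightarrow> ennreal (2*pi) * indicator (?J 0) X) at_bot"
    if AE: "(\<forall>s>0. X \<in> ?J s) \<longrightarrow> X \<in> ?J 0" for X
  proof (cases "X \<in> ?J 0")
    case True
    \<comment> \<open>On the disc of radius \<open>r\<close> the Green function at radius
      \<open>exp t\<close> is at most \<open>t + c < t\<close>, so every angle counts once
      \<open>exp t \<le> r\<close>.\<close>
    then obtain c r where c: "c < 0" "0 < r" "disc_bound \<Omega> (green \<Omega> w) w X r c"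
      by (auto simp: azukawa_sublevel_def)
    have "\<forall>\<^sub>F t in at_bot. t \<le> ln r" by (rule eventually_le_at_bot)
    then have "\<forall>\<^sub>F t in at_bot. M t X = ennreal (2*pi)"
    proof eventually_elim
      case (elim t)
      have "exp t \<le> r" using elim c(2) by (metis exp_le_cancel_iff exp_ln)
      then have "w + (of_real (exp t) * cis \<theta>) *s X \<in> \<Omega> \<and>
          green \<Omega> w (w + (of_real (exp t) * cis \<theta>) *s X) \<le> ereal (t + c)" for \<theta>
        using c(3) by (auto simp: disc_bound_def norm_mult dest!: spec[of _ "of_real (exp t) * cis \<theta>"])
      moreover have "ereal (t + c) < ereal t" using c(1) by simp
      ultimately have "cis \<theta> *s X \<in> E t" for \<theta>
        unfolding mem S_def by (metis (mono_tags, lifting) le_less_trans mem_Collect_eq)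
      then have "{\<theta> \<in> ?I. cis \<theta> *s X \<in> E t} = ?I" by auto
      then show ?case by (simp add: M_def)
    qed
    then show ?thesis using True by (simp add: tendsto_eventually)
  next
    case False
    then obtain s where s: "0 < s" "X \<notin> ?J s" using AE by blast
    obtain c r where r: "0 < r" "disc_bound \<Omega> (green \<Omega> w) w X r c" using disc_bound_green_exists[OF \<Omega>] .
    have "((\<lambda>r. emeasure lborel {t \<in> ?I. green \<Omega> w (w + (of_real r * cis t) *s X) < ereal (ln r)}) \<longlongrightarrow> 0) (at_right 0)"
      by (rule sublevel_circle_measure_tendsto_0[OF psh pole r(2,1) s(1)])
        (use s(2) in \<open>auto simp: azukawa_sublevel_def simp flip: not_less\<close>)
    from filterlim_compose[OF this lim_exp]
    have lim: "((\<lambda>t. emeasure lborel {\<theta> \<in> ?I. green \<Omega> w (w + (of_real (exp t) * cis \<theta>) *s X) < ereal t}) \<longlongrightarrow> 0) at_bot"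
      by simp
    have "\<forall>\<^sub>F t in at_bot. t \<le> ln r" by (rule eventually_le_at_bot)
    \<comment> \<open>The preceding limit does not mention membership in \<open>\<Omega>\<close>,
      whereas \<open>S t\<close> does; once the circle of radius \<open>exp t\<close> lies in
      \<open>\<Omega>\<close>, both describe the same angles.\<close>
    then have "\<forall>\<^sub>F t in at_bot. emeasure lborel {\<theta> \<in> ?I. green \<Omega> w (w + (of_real (exp t) * cis \<theta>) *s X) < ereal t} = M t X"
    proof eventually_elim
      case (elim t)
      have "exp t \<le> r" using elim r(1) by (metis exp_le_cancel_iff exp_ln)
      then have "w + (of_real (exp t) * cis \<theta>) *s X \<in> \<Omega>" for \<theta>
        using r(2) by (auto simp: disc_bound_def norm_mult)
      then show ?case by (simp add: M_def mem S_def)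
    qed
    from Lim_transform_eventually[OF lim this] show ?thesis using False by simp
  qed
  have J0: "?J 0 \<in> sets borel" using open_azukawa_sublevel[OF \<Omega>] by simp
  \<comment> \<open>Dominated convergence is sequential, so the limit is reflected to
    \<open>at_top\<close> and tested along arbitrary sequences; the factor \<open>2*pi\<close> is
    the total angle from Tonelli's theorem.\<close>
  have "((\<lambda>t. ennreal (2*pi) * emeasure lborel (E (- t))) \<longlongrightarrow> ennreal (2*pi) * emeasure lborel (?J 0)) at_top"
  proof (rule tendsto_at_topI_sequentially)
    fix T :: "nat \<Rightarrow> real" assume T: "filterlim T at_top sequentially"
    have T': "filterlim (\<lambda>k. - T k) at_bot sequentially" using T by (simp add: filterlim_uminus_at_bot)
    have "(\<lambda>k. \<integral>\<^sup>+X. M (- T k) X \<partial>lborel) \<longlonglongrightarrow> (\<integral>\<^sup>+X. ennreal (2*pi) * indicator (?J 0) X \<partial>lborel)"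
    proof (rule nn_integral_dominated_convergence[where w = "\<lambda>X. ennreal (2*pi) * indicator (ball 0 R) X"])
      show "M (- T k) \<in> borel_measurable lborel" for k
        unfolding M_def using nn_integral_circle_measure(2)[OF openE] by simp
      show "(\<lambda>X. ennreal (2*pi) * indicator (?J 0) X) \<in> borel_measurable lborel" using J0 by simp
      show "(\<lambda>X. ennreal (2*pi) * indicator (ball 0 R) X) \<in> borel_measurable (lborel :: (complex ^ 'n) measure)"
        by (intro borel_measurable_times_ennreal borel_measurable_const borel_measurable_indicator) simp
      show "(\<integral>\<^sup>+X. ennreal (2*pi) * indicator (ball 0 R) X \<partial>(lborel :: (complex ^ 'n) measure)) < \<infinity>"
        using emeasure_lborel_ball_finite[of "0 :: complex ^ 'n" R]
        by (simp add: nn_integral_cmult_indicator ennreal_mult_less_top)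
      show "AE X in lborel. (\<lambda>k. M (- T k) X) \<longlonglongrightarrow> ennreal (2*pi) * indicator (?J 0) X"
        using AE_azukawa_sublevel[OF \<Omega> R]
        by eventually_elim (rule filterlim_compose[OF M_lim T'])
    qed (use M_le in auto)
    then show "(\<lambda>k. ennreal (2*pi) * emeasure lborel (E (- T k))) \<longlonglongrightarrow> ennreal (2*pi) * emeasure lborel (?J 0)"
      unfolding M_def nn_integral_circle_measure(1)[OF openE] using J0 by (simp add: nn_integral_cmult_indicator)
  qed
  then have "((\<lambda>t. ennreal (1/(2*pi)) * (ennreal (2*pi) * emeasure lborel (E (- t))))
      \<longlongrightarrow> ennreal (1/(2*pi)) * (ennreal (2*pi) * emeasure lborel (?J 0))) at_top"
    by (rule ennreal_tendsto_cmult[rotated]) simp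
  moreover have "ennreal (1/(2*pi)) * (ennreal (2*pi) * x) = x" for x
    by (simp add: mult.assoc[symmetric] ennreal_mult[symmetric])
  ultimately have "((\<lambda>t. emeasure lborel (E t)) \<longlongrightarrow> emeasure lborel (?J 0)) at_bot"
    by (simp add: filterlim_at_bot_mirror)
  moreover have "emeasure lebesgue (azukawa_indicatrix \<Omega> w) = emeasure lborel (?J 0)"
    using J0 by (simp add: azukawa_indicatrix_eq_sublevel[OF \<Omega>])
  ultimately show ?thesis using scale by (simp add: S_def)
qed

end
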